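(* Let $k\ge 1$ and $n\ge 1$ be integers and let $t\in\mathbb{C}$ be a primitive root of unity of order $k+1$. Then the set of Hall–Littlewood polynomials $\{P_\lambda(x_1,\dots,x_n;t)\}$, where $\lambda$ ranges over all admissible partitions in $\pi_n$, is a basis of the complex vector space $F_n^{(k,2)}$.
   Context: $\pi_n$ is the set of sequences of integers $\lambda=(\lambda_1,\dots,\lambda_n)$ with $\lambda_1\ge\dots\ge\lambda_n\ge 0$; $m_i=m_i(\lambda)$ ($i\ge 0$) is the number of indices $j\in\{1,\dots,n\}$ with $\lambda_j=i$. A partition $\lambda\in\pi_n$ is admissible (for the given $k$) if $m_i(\lambda)\le k$ for all $i\ge 0$. The Hall–Littlewood polynomial is $$P_\lambda(x_1,\dots,x_n;t)=\prod_{i\ge 0}\prod_{j=1}^{m_i}\frac{1-t}{1-t^j}\sum_{w\in\mathfrak{S}_n}w\left(x_1^{\lambda_1}\cdots x_n^{\lambda_n}\prod_{1\le i<j\le n}\frac{x_i-tx_j}{x_i-x_j}\right),$$ where $w\in\mathfrak{S}_n$ acts on functions by permuting the variables. (For admissible $\lambda$ and $t$ a primitive $(k+1)$-th root of unity the denominators $1-t^j$, $j\le k$, are nonzero.) $F_n^{(k,2)}$ is the space of symmetric polynomials $f\in\mathbb{C}[x_1,\dots,x_n]^{\mathfrak{S}_n}$ satisfying $f(x,tx,t^2x,\dots,t^kx,x_{k+2},\dots,x_n)=0$ identically (no condition if $n\le k$). *)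

theory Defs
  imports
    Complex_Main
    "HOL-Library.Poly_Mapping"
    "HOL-Computational_Algebra.Polynomial_Factorial"
    "HOL-Combinatorics.Permutations"
begin

section \<open>Multivariate polynomials over the complex numbers\<close>

text \<open>
  Polynomials in the countably many variables \<open>x\<^sub>0, x\<^sub>1, \<dots>\<close>, as finitely supported
  maps from exponent vectors to coefficients.  Variables, and the entries of a
  partition, are numbered from \<open>0\<close>: the \<open>x\<^sub>i\<close> of the usual notation
  \<open>\<complex>[x\<^sub>1, \<dots>, x\<^sub>n]\<close> is \<open>mvar (i - 1)\<close>.
\<close>

type_synonym cmpoly = "(nat \<Rightarrow>\<^sub>0 nat) \<Rightarrow>\<^sub>0 complex"

definition mconst :: "complex \<Rightarrow> cmpoly" where
  "mconst c = Poly_Mapping.single 0 c"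

definition mvar :: "nat \<Rightarrow> cmpoly" where
  "mvar i = Poly_Mapping.single (Poly_Mapping.single i 1) 1"

definition mscale :: "complex \<Rightarrow> cmpoly \<Rightarrow> cmpoly" where
  "mscale c f = mconst c * f"

lemma vector_space_mscale: "vector_space mscale"
proof
  fix a b :: complex and f g :: cmpoly
  show "mscale a (f + g) = mscale a f + mscale a g"
    by (simp add: mscale_def distrib_left)
  show "mscale (a + b) f = mscale a f + mscale b f"
    by (simp add: mscale_def mconst_def single_add distrib_right)
  show "mscale a (mscale b f) = mscale (a * b) f"
    by (simp add: mscale_def mconst_def mult_single flip: mult.assoc)
  show "mscale 1 f = f"
    by (simp add: mscale_def mconst_def)
qed

definition cmpolys :: "nat \<Rightarrow> cmpoly set" where
  "cmpolys n = {f. \<forall>m \<in> Poly_Mapping.keys f. Poly_Mapping.keys m \<subseteq> {..<n}}"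

definition msubst :: "(nat \<Rightarrow> cmpoly) \<Rightarrow> cmpoly \<Rightarrow> cmpoly" where
  "msubst \<sigma> f =
     (\<Sum>m \<in> Poly_Mapping.keys f. mconst (Poly_Mapping.lookup f m) *
        (\<Prod>i \<in> Poly_Mapping.keys m. \<sigma> i ^ Poly_Mapping.lookup m i))"

definition sym_cmpolys :: "nat \<Rightarrow> cmpoly set" where
  "sym_cmpolys n =
     {f \<in> cmpolys n. \<forall>w. w permutes {..<n} \<longrightarrow> msubst (\<lambda>i. mvar (w i)) f = f}"


section \<open>The spaces \<open>F\<^sub>n\<^sup>(\<^sup>k\<^sup>,\<^sup>2\<^sup>)\<close>\<close>

definition primitive_root_of_unity :: "nat \<Rightarrow> complex \<Rightarrow> bool" where
  "primitive_root_of_unity r t \<longleftrightarrow> 0 < r \<and> t ^ r = 1 \<and> (\<forall>j. 0 < j \<and> j < r \<longrightarrow> t ^ j \<noteq> 1)"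

text \<open>
  The substitution sends the first \<open>k + 1\<close> variables to \<open>x, t x, \<dots>, t\<^sup>k x\<close>, where \<open>x\<close> is
  \<open>mvar 0\<close>, and fixes the others; as \<open>x\<close> and the remaining variables are independent
  indeterminates, the vanishing is an identity of polynomials.
\<close>

definition F_space :: "nat \<Rightarrow> nat \<Rightarrow> complex \<Rightarrow> cmpoly set" where
  "F_space n k t =
     {f \<in> sym_cmpolys n.
        k < n \<longrightarrow> msubst (\<lambda>i. if i \<le> k then mconst (t ^ i) * mvar 0 else mvar i) f = 0}"


section \<open>Partitions and Hall--Littlewood polynomials\<close>

definition partitions_len :: "nat \<Rightarrow> nat list set" where
  "partitions_len n = {lam. length lam = n \<and> sorted_wrt (\<ge>) lam}"

text \<open>The multiplicity \<open>m\<^sub>i(\<lambda>)\<close> is \<open>count_list lam i\<close>; the part \<open>i = 0\<close> is included.\<close>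

definition admissible :: "nat \<Rightarrow> nat list \<Rightarrow> bool" where
  "admissible k lam \<longleftrightarrow> (\<forall>i. count_list lam i \<le> k)"

text \<open>
  The defining formula, read in the field of rational functions.  The outer product
  runs only over the parts occurring in \<open>\<lambda>\<close>, since all other factors are empty products.
  The summand for \<open>w\<close> is the displayed one with each \<open>x\<^sub>i\<close> replaced by \<open>x\<^bsub>w(i)\<^esub>\<close>.
  The scalar is meaningful only if \<open>1 - t\<^sup>j \<noteq> 0\<close> for all \<open>j\<close> up to the largest multiplicity.
\<close>

definition hall_littlewood_fract :: "complex \<Rightarrow> nat list \<Rightarrow> cmpoly fract" where
  "hall_littlewood_fract t lam =
     (let n = length lam in
      to_fract (mconst (\<Prod>i \<in> set lam. \<Prod>j = 1..count_list lam i. (1 - t) / (1 - t ^ j))) *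
      (\<Sum>w | w permutes {..<n}.
         (\<Prod>i<n. to_fract (mvar (w i)) ^ (lam ! i)) *
         (\<Prod>(i, j) \<in> {(i, j). i < j \<and> j < n}.
            to_fract (mvar (w i) - mconst t * mvar (w j)) /
            to_fract (mvar (w i) - mvar (w j)))))"

text \<open>The above rational function is a polynomial; this is that polynomial.\<close>

definition hall_littlewood :: "complex \<Rightarrow> nat list \<Rightarrow> cmpoly" where
  "hall_littlewood t lam = (THE f. to_fract f = hall_littlewood_fract t lam)"

lemma hall_littlewood_eqI:
  "to_fract f = hall_littlewood_fract t lam \<Longrightarrow> hall_littlewood t lam = f"
  unfolding hall_littlewood_def by (rule the_equality) (metis to_fract_eq_iff)+

end

theory Submission
  imports Defs
begin

text \<open>
  Multiplied by the Vandermonde product, the sum over permutations becomes the antisymmetric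
  polynomial \<open>g = \<Sum>\<^sub>w \<plusminus> x\<^bsub>w\<^esub>\<^sup>\<lambda> \<Prod> (x\<^bsub>w i\<^esub> - t x\<^bsub>w j\<^esub>)\<close>. At \<open>x, t x, \<dots>, t\<^sup>k x\<close> every summand of \<open>g\<close> vanishes, since
  \<open>t\<close> is a root of unity of order \<open>k + 1\<close>, while the Vandermonde product does not; so all
  \<open>P\<^sub>\<lambda>\<close> with \<open>\<lambda>\<close> admissible lie in \<open>F_space\<close>.

  In the lexicographic order the leading exponent of \<open>g\<close> is \<open>\<lambda>\<close> plus that of the Vandermonde
  product, with coefficient the sum of \<open>t\<close> to the number of inversions over the stabiliser of \<open>\<lambda>\<close>. This
  is a product of sums \<open>1 + t + \<dots> + t\<^sup>m\<^sup>-\<^sup>1\<close> with \<open>m \<le> k\<close>, hence nonzero, so \<open>P\<^sub>\<lambda>\<close> has leading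
  exponent \<open>\<lambda>\<close>.

  Conversely, let \<open>\<mu>\<close> be the leading exponent of a nonzero \<open>f\<close> in \<open>F_space\<close>. If \<open>\<mu>\<close> had a block of
  \<open>k + 1\<close> equal parts, then substituting \<open>x, t x, \<dots>, t\<^sup>k x\<close> for the variables of that block would send no
  other monomial of \<open>f\<close> to the image of \<open>x\<^sup>\<mu>\<close>, so the result could not vanish. Hence \<open>\<mu>\<close> is an
  admissible partition, and subtracting multiples of the \<open>P\<^sub>\<lambda>\<close> reduces \<open>f\<close> to \<open>0\<close>.
\<close>

abbreviation "lookup \<equiv> Poly_Mapping.lookup"
abbreviation "keys \<equiv> Poly_Mapping.keys"
abbreviation "single \<equiv> Poly_Mapping.single"

section \<open>Decomposition of finitely supported maps into single terms\<close>

lemma poly_mapping_sum_singles: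
  "f = (\<Sum>m\<in>keys f. single m (lookup f m))"
proof (rule poly_mapping_eqI)
  fix k
  have "(\<Sum>m\<in>keys f. lookup (single m (lookup f m)) k)
      = (\<Sum>m\<in>keys f. if m = k then lookup f m else 0)"
    by (intro sum.cong) (auto simp: lookup_single when_def)
  also have "\<dots> = lookup f k"
    by (auto simp: sum.delta not_in_keys_iff_lookup_eq_zero)
  finally show "lookup f k = lookup (\<Sum>m\<in>keys f. single m (lookup f m)) k"
    by (simp add: lookup_sum)
qed

text \<open>Properties of substitutions that respect sums need checking only on single terms; for
  products the induction is applied to each factor in turn.\<close>

lemma poly_mapping_single_add_induct [case_names zero single add]:
  assumes zero: "P 0" and single: "\<And>m c. P (single m c)"
    and add: "\<And>f g. P f \<Longrightarrow> P g \<Longrightarrow> P (f + g)"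
  shows "P (f :: 'a \<Rightarrow>\<^sub>0 'b::comm_monoid_add)"
proof -
  have "P (\<Sum>m\<in>A. single m (lookup f m))" if "finite A" for A
    using that by (induction A) (auto intro: zero single add)
  then show ?thesis
    using poly_mapping_sum_singles[of f] by (metis finite_keys)
qed

section \<open>Substitution homomorphisms\<close>

definition monomial_subst :: "(nat \<Rightarrow> cmpoly) \<Rightarrow> (nat \<Rightarrow>\<^sub>0 nat) \<Rightarrow> cmpoly" where
  "monomial_subst \<sigma> m = (\<Prod>i\<in>keys m. \<sigma> i ^ lookup m i)"

lemma monomial_subst_superset:
  assumes "finite A" "keys m \<subseteq> A"
  shows "monomial_subst \<sigma> m = (\<Prod>i\<in>A. \<sigma> i ^ lookup m i)"
  unfolding monomial_subst_def using assms
  by (intro prod.mono_neutral_left) (auto simp: not_in_keys_iff_lookup_eq_zero)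

lemma monomial_subst_0 [simp]: "monomial_subst \<sigma> 0 = 1"
  by (simp add: monomial_subst_def)

lemma monomial_subst_single [simp]: "monomial_subst \<sigma> (single i a) = \<sigma> i ^ a"
  by (simp add: monomial_subst_def)

lemma monomial_subst_add:
  "monomial_subst \<sigma> (m + m') = monomial_subst \<sigma> m * monomial_subst \<sigma> m'"
proof -
  let ?A = "keys m \<union> keys m'"
  have "keys (m + m') \<subseteq> ?A" by (rule keys_add)
  then show ?thesis
    by (simp add: monomial_subst_superset[of ?A] lookup_add power_add prod.distrib)
qed

lemma mconst_0 [simp]: "mconst 0 = 0" and mconst_1 [simp]: "mconst 1 = 1"
  and mconst_add: "mconst (a + b) = mconst a + mconst b"
  and mconst_mult: "mconst (a * b) = mconst a * mconst b"
  and mconst_uminus: "mconst (- a) = - mconst a"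
  by (simp_all add: mconst_def single_add mult_single single_uminus)

lemma mconst_eq_iff [simp]: "mconst a = mconst b \<longleftrightarrow> a = b"
  by (metis mconst_def lookup_single_eq)

text \<open>Extra exponents have coefficient zero, so polynomials with different supports can be
  expanded over one index set.\<close>

lemma msubst_superset:
  assumes "finite A" "keys f \<subseteq> A"
  shows "msubst \<sigma> f = (\<Sum>m\<in>A. mconst (lookup f m) * monomial_subst \<sigma> m)"
  unfolding msubst_def monomial_subst_def[symmetric] using assms
  by (intro sum.mono_neutral_left) (auto simp: not_in_keys_iff_lookup_eq_zero)

lemma msubst_0 [simp]: "msubst \<sigma> 0 = 0"
  by (simp add: msubst_def)

lemma msubst_single: "msubst \<sigma> (single m c) = mconst c * monomial_subst \<sigma> m"
  by (subst msubst_superset[of "{m}"]) auto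

lemma msubst_add: "msubst \<sigma> (f + g) = msubst \<sigma> f + msubst \<sigma> g"
proof -
  let ?A = "keys f \<union> keys g"
  have "keys (f + g) \<subseteq> ?A" by (rule keys_add)
  then show ?thesis
    by (simp add: msubst_superset[of ?A] lookup_add mconst_add distrib_right sum.distrib)
qed

lemma msubst_mconst [simp]: "msubst \<sigma> (mconst c) = mconst c"
  by (simp add: mconst_def[of c] msubst_single)

lemma msubst_1 [simp]: "msubst \<sigma> 1 = 1"
  using msubst_mconst[of \<sigma> 1] by simp

lemma msubst_mvar [simp]: "msubst \<sigma> (mvar i) = \<sigma> i"
  by (simp add: mvar_def msubst_single)

lemma msubst_mult: "msubst \<sigma> (f * g) = msubst \<sigma> f * msubst \<sigma> g"
proof (induction f rule: poly_mapping_single_add_induct)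
  case (single m c)
  show ?case
    by (induction g rule: poly_mapping_single_add_induct)
      (simp_all add: mult_single msubst_single msubst_add distrib_left mconst_mult monomial_subst_add)
qed (simp_all add: msubst_add distrib_right)

lemma msubst_uminus: "msubst \<sigma> (- f) = - msubst \<sigma> f"
  using msubst_add[of \<sigma> f "- f"] by (simp add: eq_neg_iff_add_eq_0 add.commute)

lemma msubst_diff: "msubst \<sigma> (f - g) = msubst \<sigma> f - msubst \<sigma> g"
  using msubst_add[of \<sigma> f "- g"] by (simp add: msubst_uminus)

lemma msubst_sum: "msubst \<sigma> (\<Sum>i\<in>A. f i) = (\<Sum>i\<in>A. msubst \<sigma> (f i))"
  by (induction A rule: infinite_finite_induct) (auto simp: msubst_add)

lemma msubst_prod: "msubst \<sigma> (\<Prod>i\<in>A. f i) = (\<Prod>i\<in>A. msubst \<sigma> (f i))"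
  by (induction A rule: infinite_finite_induct) (auto simp: msubst_mult)

lemma msubst_power: "msubst \<sigma> (f ^ j) = msubst \<sigma> f ^ j"
  by (induction j) (auto simp: msubst_mult)

lemma msubst_mscale: "msubst \<sigma> (mscale c f) = mscale c (msubst \<sigma> f)"
  by (simp add: mscale_def msubst_mult)

lemma msubst_monomial_subst:
  "msubst \<sigma> (monomial_subst \<tau> m) = monomial_subst (\<lambda>i. msubst \<sigma> (\<tau> i)) m"
  by (simp add: monomial_subst_def msubst_prod msubst_power)

lemma msubst_msubst: "msubst \<sigma> (msubst \<tau> f) = msubst (\<lambda>i. msubst \<sigma> (\<tau> i)) f"
  by (induction f rule: poly_mapping_single_add_induct)
    (simp_all add: msubst_single msubst_mult msubst_monomial_subst msubst_add)

lemma msubst_cong: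
  assumes "f \<in> cmpolys n" "\<And>i. i < n \<Longrightarrow> \<sigma> i = \<tau> i"
  shows "msubst \<sigma> f = msubst \<tau> f"
  unfolding msubst_def using assms
  by (intro sum.cong prod.cong arg_cong2[of _ _ _ _ "(*)"]) (force simp: cmpolys_def)+

text \<open>Permutations of the variables and the specialisation to \<open>x, t x, ...\<close> both
  have this shape: a monomial goes to a single term, never to a proper sum.\<close>

lemma monomial_subst_scaled_var:
  "monomial_subst (\<lambda>i. mconst (c i) * mvar (e i)) m =
     single (\<Sum>i\<in>keys m. single (e i) (lookup m i)) (\<Prod>i\<in>keys m. c i ^ lookup m i)"
proof -
  have power: "(mconst c * mvar e) ^ a = single (single e a) (c ^ a)" for c e a
    by (induction a)
      (simp_all add: mconst_def mvar_def mult_single flip: single_add)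
  have "(\<Prod>i\<in>A. (mconst (c i) * mvar (e i)) ^ lookup m i) =
     single (\<Sum>i\<in>A. single (e i) (lookup m i)) (\<Prod>i\<in>A. c i ^ lookup m i)" if "finite A" for A
    using that by (induction A) (simp_all add: power mult_single)
  then show ?thesis by (simp add: monomial_subst_def)
qed

lemma monomial_subst_mvar:
  "monomial_subst (\<lambda>i. mvar (e i)) m = single (\<Sum>i\<in>keys m. single (e i) (lookup m i)) 1"
  using monomial_subst_scaled_var[of "\<lambda>_. 1" e m] by simp

lemma msubst_mvar_id [simp]: "msubst mvar f = f"
proof -
  have "msubst mvar (single m c) = single m c" for m c
    using poly_mapping_sum_singles[of m] monomial_subst_mvar[of "\<lambda>i. i" m]
    by (simp add: msubst_single mconst_def mult_single)
  then show ?thesis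
    by (induction f rule: poly_mapping_single_add_induct) (simp_all add: msubst_add)
qed

text \<open>Membership in \<open>cmpolys n\<close> becomes an equation, so that it passes to quotients.\<close>

lemma cmpolys_iff_msubst:
  "f \<in> cmpolys n \<longleftrightarrow> msubst (\<lambda>i. if i < n then mvar i else 0) f = f"
proof
  let ?\<tau> = "\<lambda>i. if i < n then mvar i else 0"
  assume "f \<in> cmpolys n"
  then show "msubst ?\<tau> f = f"
    using msubst_cong[of f n ?\<tau> mvar] by simp
next
  let ?\<tau> = "\<lambda>i. if i < n then mvar i else 0"
  assume fixed: "msubst ?\<tau> f = f"
  have mono: "monomial_subst ?\<tau> m = (if keys m \<subseteq> {..<n} then single m 1 else 0)" for m
  proof (cases "keys m \<subseteq> {..<n}")
    case True
    then have "monomial_subst ?\<tau> m = monomial_subst mvar m"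
      unfolding monomial_subst_def by (intro prod.cong) auto
    then show ?thesis
      using True monomial_subst_mvar[of "\<lambda>i. i" m] poly_mapping_sum_singles[of m] by simp
  next
    case False
    then obtain i where "i \<in> keys m" "\<not> i < n" by auto
    then have "\<exists>i\<in>keys m. ?\<tau> i ^ lookup m i = 0"
      by (intro bexI[of _ i]) (auto simp: in_keys_iff)
    then have "monomial_subst ?\<tau> m = 0"
      unfolding monomial_subst_def by (intro prod_zero) auto
    then show ?thesis using False by simp
  qed
  \<comment> \<open>Every image under the truncation involves only the first \<open>n\<close>
    variables, so a fixed point does too.\<close>
  have "msubst ?\<tau> g \<in> cmpolys n" for g
  proof (induction g rule: poly_mapping_single_add_induct)
    case (single m c)
    then show ?case
      by (auto simp: msubst_single mono cmpolys_def mconst_def mult_single)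
  next
    case (add f g)
    then show ?case
      using keys_add[of "msubst ?\<tau> f" "msubst ?\<tau> g"] by (auto simp: msubst_add cmpolys_def)
  qed (simp add: cmpolys_def)
  then show "f \<in> cmpolys n" using fixed by metis
qed

section \<open>Leading terms\<close>

text \<open>
  The linear order on exponent vectors is the lexicographic one in which \<open>mvar 0\<close> is the
  largest variable.  The coefficient \<open>c\<close> may be zero.
\<close>

definition lead_term :: "cmpoly \<Rightarrow> (nat \<Rightarrow>\<^sub>0 nat) \<Rightarrow> complex \<Rightarrow> bool" where
  "lead_term f m c \<longleftrightarrow> (\<exists>r. f = single m c + r \<and> (\<forall>a\<in>keys r. a < m))"

lemma lead_term_lookup: "lead_term f m c \<Longrightarrow> lookup f m = c"
  unfolding lead_term_def
  by (force simp: lookup_add not_in_keys_iff_lookup_eq_zero)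

lemma lead_term_keys_le: "lead_term f m c \<Longrightarrow> a \<in> keys f \<Longrightarrow> a \<le> m"
  unfolding lead_term_def using keys_add[of "single m c"]
  by (fastforce split: if_splits intro: less_imp_le)

lemma lead_term_single: "lead_term (single m c) m c"
  unfolding lead_term_def by (intro exI[of _ 0]) simp

lemma lead_termI:
  assumes "\<And>a. a \<in> keys f \<Longrightarrow> a \<le> m"
  shows "lead_term f m (lookup f m)"
  unfolding lead_term_def
proof (intro exI conjI ballI)
  show "f = single m (lookup f m) + (f - single m (lookup f m))" by simp
  fix a assume "a \<in> keys (f - single m (lookup f m))"
  then have "lookup f a - lookup (single m (lookup f m)) a \<noteq> 0"
    by (simp add: in_keys_iff lookup_minus)
  then have "a \<in> keys f \<and> a \<noteq> m"
    by (auto simp: in_keys_iff lookup_single when_def split: if_splits)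
  then show "a < m" using assms by (simp add: order_less_le)
qed

lemma lead_term_Max:
  "f \<noteq> 0 \<Longrightarrow> lead_term f (Max (keys f)) (lookup f (Max (keys f)))"
  by (rule lead_termI) simp

lemma lookup_Max_keys: "f \<noteq> 0 \<Longrightarrow> lookup f (Max (keys f)) \<noteq> 0"
  using Max_in[of "keys f"] by (simp add: in_keys_iff)

text \<open>A zero coefficient may sit at any exponent above the support; nonzero coefficients force
  both exponents to be the largest key.\<close>

lemma lead_term_unique:
  assumes "lead_term f m c" "lead_term f m' c'" "c \<noteq> 0" "c' \<noteq> 0"
  shows "m = m' \<and> c = c'"
  using assms by (metis in_keys_iff lead_term_keys_le lead_term_lookup order_antisym)

text \<open>The order is compatible with addition: one strict and one weak inequality between the
  factors' exponents add up to a strict one.\<close>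

lemma lead_term_mult:
  assumes "lead_term f m c" "lead_term g m' c'"
  shows "lead_term (f * g) (m + m') (c * c')"
proof -
  obtain r r' where r: "f = single m c + r" "\<forall>a\<in>keys r. a < m"
    and r': "g = single m' c' + r'" "\<forall>a\<in>keys r'. a < m'"
    using assms by (auto simp: lead_term_def)
  let ?R = "single m c * r' + r * g"
  have "f * g = single (m + m') (c * c') + ?R"
    by (simp add: r(1) r'(1) algebra_simps mult_single)
  moreover have "a < m + m'" if "a \<in> keys ?R" for a
  proof -
    from that have "a \<in> keys (single m c * r') \<or> a \<in> keys (r * g)"
      using keys_add[of "single m c * r'" "r * g"] by blast
    then show ?thesis
    proof
      assume "a \<in> keys (single m c * r')"
      then obtain x y where "a = x + y" "x \<in> keys (single m c)" "y \<in> keys r'"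
        using keys_mult[of "single m c" r'] by blast
      then have "a = m + y" "y < m'" using r'(2) by (auto split: if_splits)
      then show ?thesis by (simp add: add_strict_left_mono)
    next
      assume "a \<in> keys (r * g)"
      then obtain x y where "a = x + y" "x \<in> keys r" "y \<in> keys g"
        using keys_mult[of r g] by blast
      then have "a = x + y" "x < m" "y \<le> m'"
        using r(2) lead_term_keys_le[OF assms(2)] by auto
      then show ?thesis by (simp add: add_less_le_mono)
    qed
  qed
  ultimately show ?thesis unfolding lead_term_def by blast
qed

lemma lead_term_prod:
  assumes "\<And>i. i \<in> A \<Longrightarrow> lead_term (f i) (m i) (c i)"
  shows "lead_term (\<Prod>i\<in>A. f i) (\<Sum>i\<in>A. m i) (\<Prod>i\<in>A. c i)"
proof -
  have 1: "lead_term 1 0 1" using lead_term_single[of 0 1] by simp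
  show ?thesis using assms
    by (induction A rule: infinite_finite_induct) (simp_all add: 1 lead_term_mult)
qed

lemma lead_term_add:
  assumes "lead_term f m c" "lead_term g m d"
  shows "lead_term (f + g) m (c + d)"
proof -
  have "a \<le> m" if "a \<in> keys (f + g)" for a
    using that keys_add[of f g] assms lead_term_keys_le by blast
  from lead_termI[of "f + g" m, OF this] show ?thesis
    using assms by (simp add: lookup_add lead_term_lookup)
qed

lemma lead_term_sum:
  assumes "\<And>i. i \<in> A \<Longrightarrow> lead_term (f i) m (c i)"
  shows "lead_term (\<Sum>i\<in>A. f i) m (\<Sum>i\<in>A. c i)"
  using assms lead_term_single[of m 0]
  by (induction A rule: infinite_finite_induct) (simp_all add: lead_term_add)

text \<open>Allows summands with smaller leading exponents to enter \<open>lead_term_sum\<close> at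
  the common exponent, contributing zero.\<close>

lemma lead_term_less:
  assumes "lead_term f m c" "m < m'"
  shows "lead_term f m' 0"
proof -
  have "a < m'" if "a \<in> keys f" for a
    using lead_term_keys_le[OF assms(1) that] assms(2) by simp
  then show ?thesis unfolding lead_term_def by (intro exI[of _ f]) simp
qed

lemma lead_term_mconst: "lead_term (mconst c) 0 c"
  by (simp add: mconst_def lead_term_single)

lemma lead_term_mvar: "lead_term (mvar i) (single i 1) 1"
  by (simp add: mvar_def lead_term_single)

lemma lead_term_mvar_power: "lead_term (mvar i ^ a) (single i a) 1"
proof (induction a)
  case (Suc a)
  then show ?case
    using lead_term_mult[OF lead_term_mvar[of i] Suc] by (simp flip: single_add)
qed (use lead_term_mconst[of 1] in simp)

lemma lookup_less_iff:
  "m < m' \<longleftrightarrow> (\<exists>k. lookup m k < lookup m' k \<and> (\<forall>j<k. lookup m j = lookup m' j))"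
  by (simp add: less_poly_mapping.rep_eq less_fun_def)

lemma single_less_single: "a < b \<Longrightarrow> single b (1::nat) < single (a::nat) 1"
  unfolding lookup_less_iff by (intro exI[of _ a]) (auto simp: lookup_single when_def)

lemma lead_term_binomial:
  assumes "a \<noteq> b"
  shows "lead_term (mvar a - mconst t * mvar b) (single (min a b) 1) (if a < b then 1 else - t)"
proof -
  have a: "lead_term (mvar a) (single (min a b) 1) (if a < b then 1 else 0)"
    using lead_term_mvar[of a] lead_term_less[OF lead_term_mvar[of a] single_less_single[of b a]] assms
    by auto
  have b: "lead_term (mvar b) (single (min a b) 1) (if a < b then 0 else 1)"
    using lead_term_mvar[of b] lead_term_less[OF lead_term_mvar[of b] single_less_single[of a b]] assms
    by (auto simp: min_def)
  show ?thesis
    using lead_term_add[OF a lead_term_mult[OF lead_term_mconst[of "- t"] b, unfolded add_0_left]]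
    by (simp add: mconst_uminus split: if_splits)
qed

section \<open>Products over pairs of variables\<close>

definition pairs :: "nat \<Rightarrow> (nat \<times> nat) set" where
  "pairs n = {(i, j). i < j \<and> j < n}"

lemma finite_pairs [simp]: "finite (pairs n)"
  by (rule finite_subset[of _ "{..<n} \<times> {..<n}"]) (auto simp: pairs_def)

text \<open>A permutation acts on two-element subsets, here represented by increasing pairs.
  Injectivity suffices because \<open>pairs n\<close> is finite.\<close>

lemma bij_betw_pairs:
  assumes "w permutes {..<n}"
  shows "bij_betw (\<lambda>(i, j). (min (w i) (w j), max (w i) (w j))) (pairs n) (pairs n)"
proof -
  let ?f = "\<lambda>(i, j). (min (w i) (w j), max (w i) (w j))"
  have eq: "w i = w j \<longleftrightarrow> i = j" for i j
    using permutes_inj[OF assms] by (auto dest: injD)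
  have lt: "w i < n" if "i < n" for i
    using permutes_in_image[OF assms] that by auto
  have "?f ` pairs n \<subseteq> pairs n"
    using lt by (auto simp: pairs_def eq min_less_iff_disj less_max_iff_disj linorder_neq_iff[symmetric])
  moreover have "inj_on ?f (pairs n)"
    by (auto simp: inj_on_def pairs_def eq min_def max_def split: if_splits)
  ultimately show ?thesis
    by (simp add: bij_betw_def endo_inj_surj)
qed

lemma prod_pairs_permute:
  assumes "w permutes {..<n}" "\<And>i j. F i j = F j i"
  shows "(\<Prod>(i, j)\<in>pairs n. F (w i) (w j)) = (\<Prod>(i, j)\<in>pairs n. F i j)"
proof -
  have "F (w i) (w j) = F (min (w i) (w j)) (max (w i) (w j))" for i j
    using assms(2)[of "w i" "w j"] by (simp add: min_def max_def)
  then show ?thesis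
    using prod.reindex_bij_betw[OF bij_betw_pairs[OF assms(1)], of "\<lambda>(i, j). F i j"]
    by (simp add: case_prod_unfold)
qed

text \<open>One family covers the numerators (\<open>c = t\<close>) and the denominators
  (\<open>c = 1\<close>) of the Hall-Littlewood summands.\<close>

definition pair_prod :: "complex \<Rightarrow> nat \<Rightarrow> (nat \<Rightarrow> nat) \<Rightarrow> cmpoly" where
  "pair_prod c n w = (\<Prod>(i, j)\<in>pairs n. mvar (w i) - mconst c * mvar (w j))"

abbreviation vandermonde :: "nat \<Rightarrow> cmpoly" where
  "vandermonde n \<equiv> pair_prod 1 n id"

lemma vandermonde_eq: "vandermonde n = (\<Prod>(i, j)\<in>pairs n. mvar i - mvar j)"
  by (simp add: pair_prod_def)

text \<open>The sign of \<open>w\<close>, written over inversions and as a polynomial, so that it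
  can be distributed over the factors of \<open>pair_prod\<close>.\<close>

definition inversion_sign :: "nat \<Rightarrow> (nat \<Rightarrow> nat) \<Rightarrow> cmpoly" where
  "inversion_sign n w = (\<Prod>(i, j)\<in>pairs n. if w i < w j then 1 else - 1)"

lemma mvar_eq_iff [simp]: "mvar i = mvar j \<longleftrightarrow> i = j"
proof
  assume "mvar i = mvar j"
  then have "lookup (mvar i) (single j 1) \<noteq> 0" by (simp add: mvar_def)
  then have "single i (1::nat) = single j 1"
    by (auto simp: mvar_def lookup_single when_def split: if_splits)
  then have "lookup (single i (1::nat)) j \<noteq> 0" by simp
  then show "i = j" by (auto simp: lookup_single when_def split: if_splits)
qed simp

lemma pair_prod_1_nonzero:
  assumes "w permutes {..<n}"
  shows "pair_prod 1 n w \<noteq> 0"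
proof -
  have "w i \<noteq> w j" if "i < j" for i j
    using permutes_inj[OF assms] that by (metis injD less_irrefl)
  then have "(case p of (i, j) \<Rightarrow> mvar (w i) - mconst 1 * mvar (w j)) \<noteq> 0" if "p \<in> pairs n" for p
    using that by (cases p) (simp add: pairs_def)
  then show ?thesis by (simp add: pair_prod_def)
qed

lemma vandermonde_nonzero: "vandermonde n \<noteq> 0"
  by (rule pair_prod_1_nonzero) (rule permutes_id)

lemma inversion_sign_square: "inversion_sign n w * inversion_sign n w = 1"
  unfolding inversion_sign_def prod.distrib[symmetric] by (intro prod.neutral) auto

text \<open>Each sign reorients its factor so that the smaller index comes first. The reoriented
  factor is symmetric in the two indices, so permuting the pairs leaves the product
  unchanged.\<close>

lemma inversion_sign_pair_prod:
  assumes "w permutes {..<n}"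
  shows "inversion_sign n w * pair_prod 1 n w = vandermonde n"
proof -
  let ?F = "\<lambda>i j. if i < j then mvar i - mvar j else mvar j - mvar i"
  have eq: "w i = w j \<longleftrightarrow> i = j" for i j
    using permutes_inj[OF assms] by (auto dest: injD)
  have "inversion_sign n w * pair_prod 1 n w = (\<Prod>(i, j)\<in>pairs n. ?F (w i) (w j))"
    unfolding inversion_sign_def pair_prod_def prod.distrib[symmetric]
    by (intro prod.cong) (auto simp: pairs_def)
  also have "\<dots> = (\<Prod>(i, j)\<in>pairs n. ?F i j)"
    by (rule prod_pairs_permute[OF assms]) auto
  also have "\<dots> = vandermonde n"
    unfolding vandermonde_eq by (intro prod.cong) (auto simp: pairs_def)
  finally show ?thesis .
qed

lemma pair_prod_1_eq:
  assumes "w permutes {..<n}"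
  shows "pair_prod 1 n w = inversion_sign n w * vandermonde n"
  by (simp add: inversion_sign_square flip: inversion_sign_pair_prod[OF assms] mult.assoc)

lemma msubst_inversion_sign [simp]: "msubst \<sigma> (inversion_sign n w) = inversion_sign n w"
  unfolding inversion_sign_def msubst_prod by (intro prod.cong) (auto simp: msubst_uminus)

lemma msubst_pair_prod:
  "msubst \<sigma> (pair_prod c n w) = (\<Prod>(i, j)\<in>pairs n. \<sigma> (w i) - mconst c * \<sigma> (w j))"
  by (simp add: pair_prod_def msubst_prod case_prod_unfold msubst_diff msubst_mult)

lemma msubst_permute_pair_prod:
  "msubst (\<lambda>i. mvar (v i)) (pair_prod c n w) = pair_prod c n (v \<circ> w)"
  unfolding msubst_pair_prod by (simp add: pair_prod_def)

text \<open>Both sides measure the action of \<open>v \<circ> w\<close> on the Vandermonde product,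
  once directly and once in two stages; the nonzero product cancels.\<close>

lemma inversion_sign_compose:
  assumes "v permutes {..<n}" "w permutes {..<n}"
  shows "inversion_sign n (v \<circ> w) = inversion_sign n v * inversion_sign n w"
proof -
  have "inversion_sign n (v \<circ> w) * vandermonde n = pair_prod 1 n (v \<circ> w)"
    using pair_prod_1_eq[OF permutes_compose[OF assms(2,1)]] by simp
  also have "\<dots> = msubst (\<lambda>i. mvar (v i)) (pair_prod 1 n w)"
    by (simp add: msubst_permute_pair_prod)
  also have "\<dots> = inversion_sign n w * pair_prod 1 n v"
    by (simp add: pair_prod_1_eq[OF assms(2)] msubst_mult msubst_permute_pair_prod)
  also have "\<dots> = inversion_sign n v * inversion_sign n w * vandermonde n"
    by (simp add: pair_prod_1_eq[OF assms(1)])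
  finally show ?thesis using vandermonde_nonzero by simp
qed

section \<open>Divisibility by the Vandermonde product\<close>

lemma dvd_mult_diff:
  fixes d :: "'a::comm_ring_1"
  assumes "d dvd x - y" "d dvd x' - y'"
  shows "d dvd x * x' - y * y'"
proof -
  have "x * x' - y * y' = (x - y) * x' + y * (x' - y')" by (simp add: algebra_simps)
  then show ?thesis using assms by simp
qed

text \<open>Congruence modulo \<open>d\<close> is preserved by sums and products, hence by
  substitution into a polynomial.\<close>

lemma dvd_msubst_diff:
  assumes "\<And>i. d dvd \<sigma> i - \<tau> i"
  shows "d dvd msubst \<sigma> f - msubst \<tau> f"
proof (induction f rule: poly_mapping_single_add_induct)
  case (single m c)
  have power: "d dvd \<sigma> i ^ a - \<tau> i ^ a" for i a
    by (induction a) (simp_all add: dvd_mult_diff assms)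
  have "d dvd (\<Prod>i\<in>A. \<sigma> i ^ lookup m i) - (\<Prod>i\<in>A. \<tau> i ^ lookup m i)" if "finite A" for A
    using that by (induction A) (simp_all add: dvd_mult_diff power)
  then have "d dvd monomial_subst \<sigma> m - monomial_subst \<tau> m"
    by (simp add: monomial_subst_def)
  then show ?case
    by (simp add: msubst_single flip: right_diff_distrib)
next
  case (add f g)
  then show ?case by (simp add: msubst_add add_diff_add)
qed simp

text \<open>The factor theorem: modulo \<open>mvar a - mvar b\<close>, identifying the two variables
  does not change \<open>f\<close>.\<close>

lemma mvar_diff_dvd:
  assumes "msubst (mvar(a := mvar b)) f = 0"
  shows "mvar a - mvar b dvd f"
  using dvd_msubst_diff[of "mvar a - mvar b" mvar "mvar(a := mvar b)" f] assms by simp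

lemma msubst_merge_nonzero:
  assumes "(i, j) \<noteq> (a, b)" "i < j" "a < b"
  shows "msubst (mvar(a := mvar b)) (mvar i - mvar j) \<noteq> 0"
  using assms by (auto simp: msubst_diff)

lemma msubst_merge_prod_nonzero:
  assumes "S \<subseteq> pairs n" "(a, b) \<notin> S" "a < b"
  shows "msubst (mvar(a := mvar b)) (\<Prod>(i, j)\<in>S. mvar i - mvar j) \<noteq> 0"
proof -
  have "finite S" using assms(1) by (rule finite_subset) simp
  moreover have "msubst (mvar(a := mvar b)) (mvar i - mvar j) \<noteq> 0" if "(i, j) \<in> S" for i j
    using that assms by (intro msubst_merge_nonzero) (auto simp: pairs_def)
  ultimately show ?thesis
    by (auto simp: msubst_prod case_prod_unfold simp del: fun_upd_apply)
qed

text \<open>The binomials are split off one at a time. Identifying \<open>a\<close> with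
  \<open>b\<close> annihilates \<open>f\<close> but none of the binomials already split off, so in
  an integral domain it annihilates the cofactor, to which the factor theorem applies.\<close>

lemma vandermonde_dvd:
  assumes "\<And>a b. a < b \<Longrightarrow> b < n \<Longrightarrow> msubst (mvar(a := mvar b)) f = 0"
  shows "vandermonde n dvd f"
proof -
  have "(\<Prod>(i, j)\<in>S. mvar i - mvar j) dvd f" if "finite S" "S \<subseteq> pairs n" for S
    using that
  proof (induction S)
    case (insert p S)
    obtain a b where p: "p = (a, b)" by (cases p)
    with insert.prems have ab: "a < b" "b < n" by (auto simp: pairs_def)
    obtain h where h: "f = (\<Prod>(i, j)\<in>S. mvar i - mvar j) * h"
      using insert by auto
    have "msubst (mvar(a := mvar b)) (\<Prod>(i, j)\<in>S. mvar i - mvar j) * msubst (mvar(a := mvar b)) h = 0"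
      using assms[OF ab] by (simp only: h msubst_mult)
    then have "msubst (mvar(a := mvar b)) h = 0"
      using msubst_merge_prod_nonzero[of S n a b] insert p ab by simp
    then have "mvar a - mvar b dvd h" by (rule mvar_diff_dvd)
    then show ?case
      using insert.hyps by (simp add: p h mult_dvd_mono mult.commute)
  qed simp
  then show ?thesis by (simp add: vandermonde_eq)
qed

section \<open>Signs of transpositions\<close>

lemma msubst_merge_transpose:
  "msubst (mvar(a := mvar b)) (msubst (\<lambda>i. mvar (transpose a b i)) f) = msubst (mvar(a := mvar b)) f"
proof -
  have "(\<lambda>i. (mvar(a := mvar b)) (transpose a b i)) = mvar(a := mvar b)"
    by (auto simp: transpose_def)
  then show ?thesis by (simp add: msubst_msubst)
qed

text \<open>
  Were the sign \<open>1\<close>, the product of the other factors \<open>mvar i - mvar j\<close> would be antisymmetric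
  under the transposition, and hence vanish at \<open>mvar a = mvar b\<close>.
\<close>

lemma inversion_sign_transpose:
  assumes "a < b" "b < n"
  shows "inversion_sign n (transpose a b) = - 1"
proof -
  let ?s = "inversion_sign n (transpose a b)"
  let ?\<tau> = "\<lambda>i. mvar (transpose a b i)" and ?\<epsilon> = "mvar(a := mvar b)"
  let ?D' = "\<Prod>(i, j)\<in>pairs n - {(a, b)}. mvar i - mvar j :: cmpoly"
  have perm: "transpose a b permutes {..<n}"
    using assms by (intro permutes_swap_id) auto
  have D: "vandermonde n = (mvar a - mvar b) * ?D'"
    unfolding vandermonde_eq using assms
    by (subst prod.remove[of _ "(a, b)"]) (simp_all, simp add: pairs_def)
  have "msubst ?\<tau> (vandermonde n) = ?s * vandermonde n"
    using pair_prod_1_eq[OF perm] by (simp add: msubst_permute_pair_prod)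
  then have "(mvar b - mvar a) * msubst ?\<tau> ?D' = ?s * ((mvar a - mvar b) * ?D')"
    by (simp only: D msubst_mult msubst_diff msubst_mvar transpose_apply_first transpose_apply_second)
  then have "(mvar a - mvar b) * (msubst ?\<tau> ?D' + ?s * ?D') = 0"
    by (simp add: algebra_simps)
  then have "msubst ?\<tau> ?D' + ?s * ?D' = 0"
    using assms by simp
  then have "msubst ?\<epsilon> (msubst ?\<tau> ?D' + ?s * ?D') = 0" by simp
  then have "(1 + ?s) * msubst ?\<epsilon> ?D' = 0"
    by (simp only: msubst_add msubst_mult msubst_merge_transpose msubst_inversion_sign distrib_right mult_1)
  moreover have "msubst ?\<epsilon> ?D' \<noteq> 0"
    by (rule msubst_merge_prod_nonzero[of _ n]) (use assms in auto)
  ultimately have "1 + ?s = 0" by simp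
  then show ?thesis by (simp add: eq_neg_iff_add_eq_0 add.commute)
qed

section \<open>The symmetrised polynomial\<close>

definition monom_perm :: "(nat \<Rightarrow> nat) \<Rightarrow> nat \<Rightarrow> (nat \<Rightarrow> nat) \<Rightarrow> cmpoly" where
  "monom_perm lam n w = (\<Prod>i<n. mvar (w i) ^ lam i)"

definition hl_numerator :: "complex \<Rightarrow> nat \<Rightarrow> (nat \<Rightarrow> nat) \<Rightarrow> cmpoly" where
  "hl_numerator t n lam =
     (\<Sum>w | w permutes {..<n}. inversion_sign n w * monom_perm lam n w * pair_prod t n w)"

lemma msubst_monom_perm: "msubst \<sigma> (monom_perm lam n w) = (\<Prod>i<n. \<sigma> (w i) ^ lam i)"
  by (simp add: monom_perm_def msubst_prod msubst_power)

text \<open>Applying \<open>v\<close> turns the summand of \<open>w\<close> into that of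
  \<open>v \<circ> w\<close> up to the sign of \<open>v\<close>, and left multiplication by
  \<open>v\<close> permutes the summands.\<close>

lemma hl_numerator_antisym:
  assumes v: "v permutes {..<n}"
  shows "msubst (\<lambda>i. mvar (v i)) (hl_numerator t n lam) = inversion_sign n v * hl_numerator t n lam"
proof -
  let ?T = "\<lambda>w. inversion_sign n w * monom_perm lam n w * pair_prod t n w"
  have "msubst (\<lambda>i. mvar (v i)) (?T w) = inversion_sign n v * ?T (v \<circ> w)"
    if "w permutes {..<n}" for w
  proof -
    have "inversion_sign n w = inversion_sign n v * inversion_sign n (v \<circ> w)"
      by (simp add: inversion_sign_compose[OF v that] inversion_sign_square flip: mult.assoc)
    then show ?thesis
      unfolding msubst_mult msubst_monom_perm msubst_permute_pair_prod msubst_inversion_sign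
      by (simp add: monom_perm_def)
  qed
  then have "msubst (\<lambda>i. mvar (v i)) (hl_numerator t n lam) =
      (\<Sum>w | w permutes {..<n}. inversion_sign n v * ?T (v \<circ> w))"
    by (simp add: hl_numerator_def msubst_sum)
  also have "\<dots> = (\<Sum>w | w permutes {..<n}. inversion_sign n v * ?T w)"
    by (rule setum_permutations_compose_left[OF v, of "\<lambda>w. inversion_sign n v * ?T w", symmetric])
  finally show ?thesis by (simp add: hl_numerator_def sum_distrib_left)
qed

text \<open>When two variables are identified, an antisymmetric polynomial equals its own negative
  and so vanishes.\<close>

lemma vandermonde_dvd_hl_numerator: "vandermonde n dvd hl_numerator t n lam"
proof (rule vandermonde_dvd)
  fix a b assume ab: "a < b" "b < n"
  let ?g = "hl_numerator t n lam"
  have "transpose a b permutes {..<n}"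
    using ab by (intro permutes_swap_id) auto
  then have "msubst (\<lambda>i. mvar (transpose a b i)) ?g = - ?g"
    by (simp add: hl_numerator_antisym inversion_sign_transpose[OF ab])
  then have "msubst (mvar(a := mvar b)) ?g = - msubst (mvar(a := mvar b)) ?g"
    using msubst_merge_transpose[of a b ?g] by (simp add: msubst_uminus)
  then show "msubst (mvar(a := mvar b)) ?g = 0"
    by (simp add: eq_neg_iff_add_eq_0 flip: mult_2)
qed

text \<open>The Hall-Littlewood polynomial without its scalar factor. The quotient exists by the
  preceding divisibility and is unique because the Vandermonde product is nonzero.\<close>

definition hl_sum :: "complex \<Rightarrow> nat \<Rightarrow> (nat \<Rightarrow> nat) \<Rightarrow> cmpoly" where
  "hl_sum t n lam = (SOME R. hl_numerator t n lam = vandermonde n * R)"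

lemma vandermonde_hl_sum: "vandermonde n * hl_sum t n lam = hl_numerator t n lam"
proof -
  have "\<exists>R. hl_numerator t n lam = vandermonde n * R"
    using vandermonde_dvd_hl_numerator[of n t lam] unfolding dvd_def .
  from someI_ex[OF this] show ?thesis unfolding hl_sum_def by (rule sym)
qed

text \<open>Numerator and denominator are multiplied by the same \<open>c\<close>, which cancels:
  \<open>c\<close> is \<open>1\<close> for truncation of the variables and the sign for a
  permutation.\<close>

lemma msubst_hl_sum_eq:
  assumes "msubst \<sigma> (hl_numerator t n lam) = c * hl_numerator t n lam"
    and "msubst \<sigma> (vandermonde n) = c * vandermonde n" "c \<noteq> 0"
  shows "msubst \<sigma> (hl_sum t n lam) = hl_sum t n lam"
proof -
  have "(c * vandermonde n) * msubst \<sigma> (hl_sum t n lam) = msubst \<sigma> (vandermonde n * hl_sum t n lam)"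
    by (simp add: msubst_mult assms(2))
  also have "\<dots> = (c * vandermonde n) * hl_sum t n lam"
    by (simp add: vandermonde_hl_sum assms(1) mult.assoc)
  finally show ?thesis using assms(3) vandermonde_nonzero by simp
qed

lemma hl_sum_sym_cmpolys: "hl_sum t n lam \<in> sym_cmpolys n"
proof -
  let ?\<tau> = "\<lambda>i. if i < n then mvar i else 0"
  have w: "w i < n" if "w permutes {..<n}" "i < n" for w i
    using permutes_in_image[OF that(1)] that(2) by auto
  have "msubst ?\<tau> (pair_prod c n w) = pair_prod c n w" if "w permutes {..<n}" for c w
    unfolding msubst_pair_prod unfolding pair_prod_def
  proof (intro prod.cong refl)
    fix p assume "p \<in> pairs n"
    then have "fst p < n" "snd p < n" by (auto simp: pairs_def)
    then show "(case p of (i, j) \<Rightarrow> ?\<tau> (w i) - mconst c * ?\<tau> (w j)) =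
        (case p of (i, j) \<Rightarrow> mvar (w i) - mconst c * mvar (w j))"
      using w[OF that] by (simp add: case_prod_unfold)
  qed
  moreover have "msubst ?\<tau> (monom_perm lam n w) = monom_perm lam n w" if "w permutes {..<n}" for w
    unfolding msubst_monom_perm unfolding monom_perm_def
    by (intro prod.cong) (simp_all add: w[OF that])
  ultimately have "msubst ?\<tau> (hl_numerator t n lam) = hl_numerator t n lam"
    "msubst ?\<tau> (vandermonde n) = vandermonde n"
    using permutes_id[of "{..<n}"] by (simp_all add: hl_numerator_def msubst_sum msubst_mult)
  then have "msubst ?\<tau> (hl_sum t n lam) = hl_sum t n lam"
    using msubst_hl_sum_eq[of ?\<tau> t n lam 1] by simp
  then have "hl_sum t n lam \<in> cmpolys n" by (simp add: cmpolys_iff_msubst)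
  moreover have "msubst (\<lambda>i. mvar (v i)) (hl_sum t n lam) = hl_sum t n lam"
    if v: "v permutes {..<n}" for v
  proof (rule msubst_hl_sum_eq)
    show "msubst (\<lambda>i. mvar (v i)) (vandermonde n) = inversion_sign n v * vandermonde n"
      using pair_prod_1_eq[OF v] by (simp add: msubst_permute_pair_prod)
    show "inversion_sign n v \<noteq> 0"
      using inversion_sign_square[of n v] by auto
  qed (rule hl_numerator_antisym[OF v])
  ultimately show ?thesis by (simp add: sym_cmpolys_def)
qed

text \<open>
  Position \<open>inv w i\<close> is where the variable \<open>i\<close> stands. The factors \<open>x\<^sub>i\<^sub>+\<^sub>1 - t x\<^sub>i\<close> force the positions
  of \<open>0, \<dots>, k\<close> to increase, and then \<open>x\<^sub>0 - t x\<^sub>k\<close> vanishes because \<open>t ^ (k + 1) = 1\<close>.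
\<close>

lemma pair_prod_vanish:
  assumes "k \<ge> 1" "k < n" "t ^ (k + 1) = 1" "w permutes {..<n}"
  shows "msubst (\<lambda>i. if i \<le> k then mconst (t ^ i) * mvar 0 else mvar i) (pair_prod t n w) = 0"
proof -
  let ?\<theta> = "\<lambda>i. if i \<le> k then mconst (t ^ i) * mvar 0 else mvar i"
  let ?p = "inv w"
  have p: "w (?p i) = i" "?p permutes {..<n}" for i
    using assms(4) by (auto simp: permutes_inverses permutes_inv)
  have lt: "?p i < n" if "i < n" for i
    using permutes_in_image[OF p(2)] that by auto
  have "\<exists>a b. a \<le> k \<and> b \<le> k \<and> ?p a < ?p b \<and> ?\<theta> a = mconst t * ?\<theta> b"
  proof (cases "\<exists>b<k. ?p (Suc b) < ?p b")
    case True
    then obtain b where "b < k" "?p (Suc b) < ?p b" by auto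
    then show ?thesis
      by (intro exI[of _ "Suc b"] exI[of _ b]) (auto simp: mconst_mult)
  next
    case False
    then have le: "?p b \<le> ?p (Suc b)" if "b < k" for b using that by auto
    have "?p 0 \<le> ?p j" if "j \<le> k" for j
      using that
    proof (induction j)
      case (Suc j)
      then show ?case using le[of j] by simp
    qed simp
    moreover have "?p 0 \<noteq> ?p k"
      using assms(1) p(1) by (metis not_one_le_zero)
    ultimately have "?p 0 < ?p k" by (simp add: order_less_le)
    moreover have "mconst t * (mconst (t ^ k) * mvar 0) = mvar 0"
      using assms(3) by (simp flip: mconst_mult mult.assoc)
    ultimately show ?thesis
      by (intro exI[of _ 0] exI[of _ k]) auto
  qed
  then obtain a b where ab: "a \<le> k" "b \<le> k" "?p a < ?p b" "?\<theta> a = mconst t * ?\<theta> b" by blast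
  have "(?p a, ?p b) \<in> pairs n" using ab assms(2) lt by (simp add: pairs_def)
  moreover have "?\<theta> (w (?p a)) - mconst t * ?\<theta> (w (?p b)) = 0" using ab(4) by (simp only: p diff_self)
  ultimately show ?thesis
    unfolding msubst_pair_prod by (intro prod_zero) (auto intro!: bexI[of _ "(?p a, ?p b)"])
qed

section \<open>Nonvanishing of the Vandermonde product at the specialisation\<close>

lemma mvar_nonzero [simp]: "mvar i \<noteq> 0"
  by (metis mvar_def lookup_single_eq lookup_zero zero_neq_one)

text \<open>Setting \<open>mvar i\<close> to zero kills the left side, but not the right side if
  \<open>i \<noteq> j\<close>.\<close>

lemma mconst_mvar_eq_mvar:
  assumes "mconst c * mvar i = mvar j"
  shows "i = j"
proof (rule ccontr)
  assume "i \<noteq> j"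
  then have "msubst (mvar(i := 0)) (mconst c * mvar i) \<noteq> msubst (mvar(i := 0)) (mvar j)"
    by (simp add: msubst_mult del: msubst_mvar) simp
  with assms show False by simp
qed

lemma hl_sum_F_space:
  assumes "k \<ge> 1" "primitive_root_of_unity (k + 1) t"
  shows "hl_sum t n lam \<in> F_space n k t"
proof -
  let ?\<theta> = "\<lambda>i. if i \<le> k then mconst (t ^ i) * mvar 0 else mvar i"
  have t: "t ^ (k + 1) = 1" and ne: "\<And>j. 0 < j \<Longrightarrow> j < k + 1 \<Longrightarrow> t ^ j \<noteq> 1"
    using assms(2) unfolding primitive_root_of_unity_def by auto
  then have t0: "t \<noteq> 0" by auto
  have inj: "t ^ i \<noteq> t ^ j" if "i < j" "j \<le> k" for i j
  proof
    assume "t ^ i = t ^ j"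
    also have "\<dots> = t ^ i * t ^ (j - i)" using that by (simp flip: power_add)
    finally show False using ne[of "j - i"] that t0 by simp
  qed
  \<comment> \<open>Up to index \<open>k\<close> the powers of \<open>t\<close> are distinct; beyond
    \<open>k\<close> the variables themselves differ from \<open>mvar 0\<close> and from each
    other.\<close>
  have \<theta>: "?\<theta> i \<noteq> ?\<theta> j" if "i < j" for i j
    using that inj[of i j] by (auto dest: mconst_mvar_eq_mvar)
  have "msubst ?\<theta> (hl_sum t n lam) = 0" if "k < n"
  proof -
    have "msubst ?\<theta> (hl_numerator t n lam) = 0"
      using pair_prod_vanish[OF assms(1) that t]
      by (simp add: hl_numerator_def msubst_sum msubst_mult)
    moreover have "msubst ?\<theta> (vandermonde n) \<noteq> 0"
    proof -
      have "(case p of (i, j) \<Rightarrow> ?\<theta> (id i) - mconst 1 * ?\<theta> (id j)) \<noteq> 0" if "p \<in> pairs n" for p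
        using that \<theta>[of "fst p" "snd p"]
        by (simp only: pairs_def case_prod_unfold mem_Collect_eq id_apply mconst_1 mult_1 right_minus_eq not_False_eq_True)
      then show ?thesis unfolding msubst_pair_prod by (simp only: prod_zero_iff finite_pairs simp_thms) blast
    qed
    moreover have "msubst ?\<theta> (vandermonde n) * msubst ?\<theta> (hl_sum t n lam) =
        msubst ?\<theta> (hl_numerator t n lam)"
      by (simp only: vandermonde_hl_sum flip: msubst_mult)
    ultimately show ?thesis by (simp only: mult_eq_0_iff simp_thms)
  qed
  then show ?thesis using hl_sum_sym_cmpolys by (simp add: F_space_def)
qed

section \<open>The leading term of the symmetrised polynomial\<close>

definition exponent :: "nat \<Rightarrow> (nat \<Rightarrow> nat) \<Rightarrow> (nat \<Rightarrow>\<^sub>0 nat)" where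
  "exponent n lam = (\<Sum>i<n. single i (lam i))"

lemma lookup_exponent: "lookup (exponent n lam) l = (if l < n then lam l else 0)"
proof -
  have "lookup (exponent n lam) l = (\<Sum>i<n. if i = l then lam i else 0)"
    unfolding exponent_def lookup_sum by (intro sum.cong) (auto simp: lookup_single when_def)
  then show ?thesis by simp
qed

lemma exponent_eq_iff: "exponent n f = exponent n g \<longleftrightarrow> (\<forall>i<n. f i = g i)"
proof
  assume "exponent n f = exponent n g"
  then have "lookup (exponent n f) i = lookup (exponent n g) i" for i by simp
  then show "\<forall>i<n. f i = g i" unfolding lookup_exponent by metis
qed (simp add: exponent_def)

text \<open>If position \<open>l\<close> were the first to increase, too many entries would be at least \<open>lam (v l)\<close>.\<close>

lemma exponent_permute_le:
  assumes antimono: "\<And>i j. i \<le> j \<Longrightarrow> j < n \<Longrightarrow> lam j \<le> lam i" and v: "v permutes {..<n}"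
  shows "exponent n (lam \<circ> v) \<le> exponent n lam"
proof (rule ccontr)
  assume "\<not> ?thesis"
  then have "exponent n lam < exponent n (lam \<circ> v)" by simp
  then obtain l where less: "lookup (exponent n lam) l < lookup (exponent n (lam \<circ> v)) l"
    and eq: "\<And>j. j < l \<Longrightarrow> lookup (exponent n lam) j = lookup (exponent n (lam \<circ> v)) j"
    unfolding lookup_less_iff by auto
  from less have l: "l < n" "lam l < lam (v l)"
    by (simp_all add: lookup_exponent split: if_splits)
  have eq: "lam j = lam (v j)" if "j < l" for j
    using eq[OF that] that l(1) by (simp add: lookup_exponent)
  \<comment> \<open>\<open>v\<close> maps \<open>T\<close> onto \<open>S\<close>, so they have equal
    size, yet \<open>T\<close> contains \<open>S\<close> together with the further element
    \<open>l\<close>.\<close>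
  define S where "S = {q. q < n \<and> lam (v l) \<le> lam q}"
  define T where "T = {q. q < n \<and> lam (v l) \<le> lam (v q)}"
  have S: "q < l" if "q \<in> S" for q
  proof (rule ccontr)
    assume "\<not> q < l"
    then have "lam q \<le> lam l" using antimono[of l q] that by (simp add: S_def)
    then show False using that l(2) by (simp add: S_def)
  qed
  have v_lt: "v q < n \<longleftrightarrow> q < n" for q using permutes_in_image[OF v, of q] by simp
  have "S = v ` T"
  proof
    show "S \<subseteq> v ` T"
    proof
      fix q assume q: "q \<in> S"
      obtain r where r: "q = v r" using permutes_surj[OF v] by (meson surj_def)
      then have "r \<in> T" using q v_lt by (simp add: S_def T_def)
      then show "q \<in> v ` T" using r by simp
    qed
    show "v ` T \<subseteq> S" using v_lt by (auto simp: S_def T_def)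
  qed
  moreover have "card (v ` T) = card T"
    by (rule card_image) (rule inj_on_subset[OF permutes_inj[OF v] subset_UNIV])
  ultimately have "card S = card T" by simp
  moreover have "insert l S \<subseteq> T"
  proof
    fix q assume q: "q \<in> insert l S"
    show "q \<in> T"
    proof (cases "q = l")
      case False
      with q have "q \<in> S" by simp
      with eq[OF S[OF \<open>q \<in> S\<close>]] show ?thesis by (simp add: S_def T_def)
    qed (use l in \<open>simp add: T_def\<close>)
  qed
  then have "card (insert l S) \<le> card T" by (rule card_mono[rotated]) (simp add: T_def)
  moreover have "l \<notin> S" using S by blast
  moreover have "finite S" by (simp add: S_def)
  ultimately show False by simp
qed

section \<open>Leading coefficients as sums of \<open>t\<close> to the number of inversions\<close>

definition inversion_weight :: "complex \<Rightarrow> nat \<Rightarrow> (nat \<Rightarrow> nat) \<Rightarrow> complex" where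
  "inversion_weight t n w = (\<Prod>(i, j)\<in>pairs n. if w i < w j then 1 else t)"

definition stabilizer :: "nat \<Rightarrow> (nat \<Rightarrow> nat) \<Rightarrow> (nat \<Rightarrow> nat) set" where
  "stabilizer n lam = {w. w permutes {..<n} \<and> (\<forall>i<n. lam (w i) = lam i)}"

text \<open>The staircase \<open>(n - 1, n - 2, ..., 0)\<close>, in the form in which a product over
  pairs delivers it.\<close>

definition vandermonde_exponent :: "nat \<Rightarrow> (nat \<Rightarrow>\<^sub>0 nat)" where
  "vandermonde_exponent n = (\<Sum>(i, j)\<in>pairs n. single i 1)"

text \<open>In each binomial the variable of smaller index leads, with coefficient \<open>1\<close>
  or, after the sign is absorbed, \<open>t\<close> at an inversion. Hence the leading exponent is
  the same for all \<open>w\<close>.\<close>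

lemma lead_term_signed_pair_prod:
  assumes w: "w permutes {..<n}"
  shows "lead_term (inversion_sign n w * pair_prod t n w) (vandermonde_exponent n) (inversion_weight t n w)"
proof -
  have ne: "w i \<noteq> w j" if "i < j" for i j
    using permutes_inj[OF w] that by (metis injD less_irrefl)
  have "lead_term ((if a < b then 1 else - 1) * (mvar a - mconst t * mvar b))
      (single (min a b) 1) (if a < b then 1 else t)" if "a \<noteq> b" for a b
    using lead_term_mult[OF lead_term_mconst[of "if a < b then 1 else - 1"] lead_term_binomial[OF that, of t]]
    by (simp add: mconst_uminus split: if_splits)
  note factor = this
  have "lead_term (\<Prod>p\<in>pairs n. (if w (fst p) < w (snd p) then 1 else - 1) *
        (mvar (w (fst p)) - mconst t * mvar (w (snd p))))
      (\<Sum>p\<in>pairs n. single (min (w (fst p)) (w (snd p))) 1)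
      (\<Prod>p\<in>pairs n. if w (fst p) < w (snd p) then 1 else t)"
    by (intro lead_term_prod factor ne) (auto simp: pairs_def)
  moreover have "(\<Sum>p\<in>pairs n. single (min (w (fst p)) (w (snd p))) (1::nat)) = vandermonde_exponent n"
    using sum.reindex_bij_betw[OF bij_betw_pairs[OF w], of "\<lambda>p. single (fst p) (1::nat)"]
    by (simp add: vandermonde_exponent_def case_prod_unfold)
  ultimately show ?thesis
    by (simp add: inversion_sign_def pair_prod_def inversion_weight_def case_prod_unfold prod.distrib)
qed

lemma lead_term_vandermonde: "lead_term (vandermonde n) (vandermonde_exponent n) 1"
proof -
  have "inversion_sign n id = 1" "inversion_weight 1 n id = 1"
    unfolding inversion_sign_def inversion_weight_def by (auto intro!: prod.neutral simp: pairs_def)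
  then show ?thesis
    using lead_term_signed_pair_prod[OF permutes_id, of n 1] by simp
qed

lemma lead_term_monom_perm:
  assumes w: "w permutes {..<n}"
  shows "lead_term (monom_perm lam n w) (exponent n (lam \<circ> inv w)) 1"
proof -
  have "lead_term (monom_perm lam n w) (\<Sum>i<n. single (w i) (lam i)) (\<Prod>i<n. 1)"
    unfolding monom_perm_def by (rule lead_term_prod) (rule lead_term_mvar_power)
  moreover have "exponent n (lam \<circ> inv w) = (\<Sum>i<n. single (w i) (lam i))"
    unfolding exponent_def
    by (subst sum.permute[OF w]) (simp add: o_def permutes_inverses[OF w])
  ultimately show ?thesis by simp
qed

text \<open>The binomial products share one leading exponent, so only the monomials compete, and
  these reach \<open>exponent n lam\<close> exactly for \<open>w\<close> in the stabiliser.\<close>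

lemma lead_term_hl_numerator:
  assumes antimono: "\<And>i j. i \<le> j \<Longrightarrow> j < n \<Longrightarrow> lam j \<le> lam i"
  shows "lead_term (hl_numerator t n lam) (exponent n lam + vandermonde_exponent n)
    (\<Sum>w\<in>stabilizer n lam. inversion_weight t n w)"
proof -
  let ?c = "\<lambda>w. if w \<in> stabilizer n lam then inversion_weight t n w else 0"
  have "lead_term (inversion_sign n w * monom_perm lam n w * pair_prod t n w)
      (exponent n lam + vandermonde_exponent n) (?c w)" if w: "w permutes {..<n}" for w
  proof -
    have lt: "w i < n \<longleftrightarrow> i < n" "inv w i < n \<longleftrightarrow> i < n" for i
      using permutes_in_image[OF w, of i] permutes_in_image[OF permutes_inv[OF w], of i] by simp_all
    have "(\<forall>i<n. lam (w i) = lam i) \<longleftrightarrow> (\<forall>i<n. (lam \<circ> inv w) i = lam i)"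
    proof (intro iffI allI impI)
      fix i assume "\<forall>i<n. lam (w i) = lam i" "i < n"
      then have "lam (w (inv w i)) = lam (inv w i)" using lt by blast
      then show "(lam \<circ> inv w) i = lam i" by (simp add: permutes_inverses[OF w])
    next
      fix i assume "\<forall>i<n. (lam \<circ> inv w) i = lam i" "i < n"
      then have "(lam \<circ> inv w) (w i) = lam (w i)" using lt by blast
      then show "lam (w i) = lam i" by (simp add: permutes_inverses[OF w])
    qed
    then have "w \<in> stabilizer n lam \<longleftrightarrow> exponent n (lam \<circ> inv w) = exponent n lam"
      using w by (simp add: stabilizer_def exponent_eq_iff)
    moreover have "exponent n (lam \<circ> inv w) \<le> exponent n lam"
      by (rule exponent_permute_le[OF antimono permutes_inv[OF w]])
    ultimately have "lead_term (monom_perm lam n w) (exponent n lam)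
        (if w \<in> stabilizer n lam then 1 else 0)"
      using lead_term_monom_perm[OF w, of lam] by (auto intro: lead_term_less simp: order_less_le)
    from lead_term_mult[OF this lead_term_signed_pair_prod[OF w, of t]] show ?thesis
      by (simp add: ac_simps split: if_splits)
  qed
  then have "lead_term (hl_numerator t n lam) (exponent n lam + vandermonde_exponent n)
      (\<Sum>w | w permutes {..<n}. ?c w)"
    unfolding hl_numerator_def by (intro lead_term_sum) simp
  also have "(\<Sum>w | w permutes {..<n}. ?c w) = (\<Sum>w\<in>stabilizer n lam. inversion_weight t n w)"
    by (intro sum.mono_neutral_cong_right) (auto simp: stabilizer_def finite_permutations)
  finally show ?thesis .
qed

text \<open>
  The cycle taking position \<open>p\<close> to \<open>n\<close> and shifting \<open>p + 1, \<dots>, n\<close> down. A permutation \<open>w\<close> of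
  \<open>{..n}\<close> with \<open>w p = n\<close> factors uniquely as a permutation of \<open>{..<n}\<close> after this cycle, which
  accounts for \<open>n - p\<close> inversions.
\<close>

definition cycle_up :: "nat \<Rightarrow> nat \<Rightarrow> nat \<Rightarrow> nat" where
  "cycle_up n p q = (if q = p then n else if p < q \<and> q \<le> n then q - 1 else q)"

definition cycle_down :: "nat \<Rightarrow> nat \<Rightarrow> nat \<Rightarrow> nat" where
  "cycle_down n p q = (if q = n then p else if p \<le> q \<and> q < n then q + 1 else q)"

lemma cycle_up_down [simp]:
  assumes "p \<le> n"
  shows "cycle_up n p (cycle_down n p q) = q" "cycle_down n p (cycle_up n p q) = q"
  using assms by (auto simp: cycle_up_def cycle_down_def)

lemma cycle_permutes:
  assumes "p \<le> n"
  shows "cycle_up n p permutes {..<Suc n}" "cycle_down n p permutes {..<Suc n}"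
proof -
  have "bij (cycle_up n p)" "bij (cycle_down n p)"
    by (rule o_bij[of "cycle_down n p"] o_bij[of "cycle_up n p"]; simp add: fun_eq_iff assms)+
  then show "cycle_up n p permutes {..<Suc n}" "cycle_down n p permutes {..<Suc n}"
    using assms by (auto simp: permutes_def bij_iff cycle_up_def cycle_down_def)
qed

text \<open>Reindexing along \<open>cycle_down\<close> turns the values of the composite into those
  of \<open>u\<close>. Pairs below \<open>n\<close> give the inversions of \<open>u\<close>, and
  \<open>(a, n)\<close> gives one exactly when \<open>p \<le> a\<close>.\<close>

lemma inversion_weight_cycle:
  assumes p: "p \<le> n" and u: "u permutes {..<n}"
  shows "inversion_weight t (Suc n) (u \<circ> cycle_up n p) = t ^ (n - p) * inversion_weight t n u"
proof -
  let ?w = "u \<circ> cycle_up n p" and ?d = "cycle_down n p"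
  let ?W = "\<lambda>(i, j). if ?w i < ?w j then 1 else t"
  let ?f = "\<lambda>(i, j). (min (?d i) (?d j), max (?d i) (?d j))"
  have wd: "?w (?d a) = u a" for a using p by simp
  have un: "u n = n" "\<And>a. a < n \<Longrightarrow> u a < n"
    using permutes_not_in[OF u, of n] permutes_in_image[OF u] by auto
  have split: "pairs (Suc n) = pairs n \<union> (\<lambda>a. (a, n)) ` {..<n}"
    by (auto simp: pairs_def less_Suc_eq)
  have "inversion_weight t (Suc n) ?w = prod (\<lambda>x. ?W (?f x)) (pairs (Suc n))"
    unfolding inversion_weight_def
    by (rule prod.reindex_bij_betw[OF bij_betw_pairs[OF cycle_permutes(2)[OF p]], symmetric])
  also have "\<dots> = prod (\<lambda>x. ?W (?f x)) (pairs n) * prod (\<lambda>x. ?W (?f x)) ((\<lambda>a. (a, n)) ` {..<n})"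
    unfolding split by (rule prod.union_disjoint) (simp_all, auto simp: pairs_def)
  also have "prod (\<lambda>x. ?W (?f x)) (pairs n) = inversion_weight t n u"
    unfolding inversion_weight_def
  proof (rule prod.cong[OF refl])
    fix x assume x: "x \<in> pairs n"
    obtain a b where ab: "x = (a, b)" by (cases x)
    with x have "?d a < ?d b" by (auto simp: pairs_def cycle_down_def)
    then have "min (?d a) (?d b) = ?d a" "max (?d a) (?d b) = ?d b" by auto
    then show "?W (?f x) = (case x of (i, j) \<Rightarrow> if u i < u j then 1 else t)"
      by (simp only: ab prod.case wd)
  qed
  also have "prod (\<lambda>x. ?W (?f x)) ((\<lambda>a. (a, n)) ` {..<n}) = (\<Prod>a<n. ?W (?f (a, n)))"
    by (subst prod.reindex) (auto simp: inj_on_def)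
  also have "\<dots> = (\<Prod>a<n. if a < p then 1 else t)"
  proof (rule prod.cong[OF refl])
    fix a assume "a \<in> {..<n}"
    then have a: "a < n" by simp
    show "?W (?f (a, n)) = (if a < p then 1 else t)"
    proof (cases "a < p")
      case True
      then have "?d a < ?d n" using a by (simp add: cycle_down_def)
      then have "min (?d a) (?d n) = ?d a" "max (?d a) (?d n) = ?d n" by auto
      then show ?thesis using True by (simp only: prod.case wd un(1)) (simp add: un(2)[OF a])
    next
      case False
      then have "?d n < ?d a" using a by (simp add: cycle_down_def)
      then have "min (?d a) (?d n) = ?d n" "max (?d a) (?d n) = ?d a" by auto
      then show ?thesis using False by (simp only: prod.case wd un(1)) (simp add: less_not_sym[OF un(2)[OF a]])
    qed
  qed
  also have "\<dots> = (\<Prod>a\<in>{p..<n}. t)"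
    by (rule prod.mono_neutral_cong_right) auto
  also have "\<dots> = t ^ (n - p)" by simp
  finally show ?thesis by (simp only: mult.commute)
qed

text \<open>If \<open>w\<close> in the stabiliser sends \<open>p\<close> to \<open>n\<close>, then
  \<open>lam p = lam n\<close>, and monotonicity makes \<open>lam\<close> constant on
  \<open>p, ..., n\<close>. The cycle at \<open>p\<close> therefore preserves \<open>lam\<close>,
  and so does the other factor of \<open>w\<close>.\<close>

lemma sum_stabilizer_Suc:
  assumes antimono: "\<And>i j. i \<le> j \<Longrightarrow> j \<le> n \<Longrightarrow> lam j \<le> lam i"
  shows "(\<Sum>w\<in>stabilizer (Suc n) lam. inversion_weight t (Suc n) w) =
    (\<Sum>p | p \<le> n \<and> lam p = lam n. t ^ (n - p)) * (\<Sum>u\<in>stabilizer n lam. inversion_weight t n u)"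
proof -
  define B where "B = {p. p \<le> n \<and> lam p = lam n}"
  have lam_B: "lam q = lam n" if "p \<in> B" "p \<le> q" "q \<le> n" for p q
    using antimono[of p q] antimono[of q n] that by (simp add: B_def)
  have lam_up: "lam (cycle_up n p q) = lam q" if "p \<in> B" for p q
  proof (cases "p \<le> q \<and> q \<le> n")
    case True
    then have "lam (cycle_up n p q) = lam n"
      using that lam_B[of p "q - 1"] by (auto simp: cycle_up_def)
    then show ?thesis using lam_B[of p q] that True by simp
  qed (use that in \<open>auto simp: cycle_up_def B_def\<close>)
  have lam_down: "lam (cycle_down n p q) = lam q" if "p \<in> B" for p q
    using lam_up[OF that, of "cycle_down n p q"] that by (simp add: B_def)
  have stab: "lam (u q) = lam q" if "u \<in> stabilizer m lam" for u m q
    using that permutes_not_in[of u "{..<m}" q] by (cases "q < m") (auto simp: stabilizer_def)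
  have "(\<Sum>w\<in>stabilizer (Suc n) lam. inversion_weight t (Suc n) w) =
      (\<Sum>(p, u)\<in>B \<times> stabilizer n lam. t ^ (n - p) * inversion_weight t n u)"
  proof (rule sum.reindex_bij_witness[of _ "\<lambda>(p, u). u \<circ> cycle_up n p"
        "\<lambda>w. (inv w n, w \<circ> cycle_down n (inv w n))"])
    fix w assume w: "w \<in> stabilizer (Suc n) lam"
    define p where "p = inv w n"
    have perm: "w permutes {..<Suc n}" using w by (simp add: stabilizer_def)
    have wp: "w p = n" using permutes_inverses[OF perm] by (simp add: p_def)
    have "p \<le> n" using permutes_in_image[OF perm, of p] wp by simp
    then have pB: "p \<in> B" using stab[OF w, of p] wp by (simp add: B_def)
    note comp = permutes_compose[OF cycle_permutes(2)[OF \<open>p \<le> n\<close>] perm]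
    have "w \<circ> cycle_down n p permutes {..<n}"
      by (rule permutes_superset[OF comp]) (auto simp: cycle_down_def wp)
    then have u: "w \<circ> cycle_down n p \<in> stabilizer n lam"
      using stab[OF w] lam_down[OF pB] by (simp add: stabilizer_def)
    have inverse: "w \<circ> cycle_down n p \<circ> cycle_up n p = w"
      using \<open>p \<le> n\<close> by (simp add: fun_eq_iff)
    show "(inv w n, w \<circ> cycle_down n (inv w n)) \<in> B \<times> stabilizer n lam"
      using pB u by (simp add: p_def)
    show "(case (inv w n, w \<circ> cycle_down n (inv w n)) of (p, u) \<Rightarrow> u \<circ> cycle_up n p) = w"
      using inverse by (simp add: p_def)
    show "(case (inv w n, w \<circ> cycle_down n (inv w n)) of (p, u) \<Rightarrow>
        t ^ (n - p) * inversion_weight t n u) = inversion_weight t (Suc n) w"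
      using inversion_weight_cycle[OF \<open>p \<le> n\<close>, of "w \<circ> cycle_down n p" t] u inverse
      by (simp add: p_def stabilizer_def)
  next
    fix x assume "x \<in> B \<times> stabilizer n lam"
    then obtain p u where x: "x = (p, u)" "p \<in> B" "u \<in> stabilizer n lam" by auto
    have p: "p \<le> n" using x by (simp add: B_def)
    have perm: "u permutes {..<n}" using x by (simp add: stabilizer_def)
    then have "u permutes {..<Suc n}" by (rule permutes_subset) auto
    note comp = permutes_compose[OF cycle_permutes(1)[OF p] this]
    show "(case x of (p, u) \<Rightarrow> u \<circ> cycle_up n p) \<in> stabilizer (Suc n) lam"
      using comp stab[OF x(3)] lam_up[OF x(2)] by (simp add: x stabilizer_def)
    have "(u \<circ> cycle_up n p) p = n"
      using permutes_not_in[OF perm, of n] by (simp add: cycle_up_def)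
    then have "inv (u \<circ> cycle_up n p) n = p"
      using inv_f_f[OF permutes_inj[OF comp], of p] by simp
    then show "(inv (case x of (p, u) \<Rightarrow> u \<circ> cycle_up n p) n,
        (case x of (p, u) \<Rightarrow> u \<circ> cycle_up n p) \<circ>
        cycle_down n (inv (case x of (p, u) \<Rightarrow> u \<circ> cycle_up n p) n)) = x"
      using p by (simp add: x fun_eq_iff)
  qed
  then show ?thesis
    by (simp add: B_def sum_product sum.cartesian_product)
qed

text \<open>Each step of the induction contributes a geometric sum whose length is the size so far
  of the block of the last entry. This is at most \<open>k\<close>, below the order of
  \<open>t\<close>.\<close>

lemma sum_stabilizer_nonzero:
  assumes t: "primitive_root_of_unity (k + 1) t"
    and "\<And>i j. i \<le> j \<Longrightarrow> j < n \<Longrightarrow> lam j \<le> lam i" "\<And>i. card {p. p < n \<and> lam p = i} \<le> k"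
  shows "(\<Sum>w\<in>stabilizer n lam. inversion_weight t n w) \<noteq> 0"
  using assms(2,3)
proof (induction n)
  case 0
  have "stabilizer 0 lam = {id}" by (auto simp: stabilizer_def)
  then show ?case by (simp add: inversion_weight_def pairs_def)
next
  case (Suc n)
  have antimono: "lam j \<le> lam i" if "i \<le> j" "j \<le> n" for i j
    using Suc.prems(1) that by simp
  let ?B = "{p. p \<le> n \<and> lam p = lam n}"
  define p0 where "p0 = (LEAST p. p \<le> n \<and> lam p = lam n)"
  have p0: "p0 \<le> n" "lam p0 = lam n"
    using LeastI[of "\<lambda>p. p \<le> n \<and> lam p = lam n" n] by (simp_all add: p0_def)
  \<comment> \<open>As \<open>lam\<close> is weakly decreasing, the positions of its last value form
    a final interval.\<close>
  have "?B = {p0..n}"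
  proof (intro set_eqI iffI)
    fix q assume "q \<in> ?B"
    then show "q \<in> {p0..n}" by (auto simp: p0_def intro: Least_le)
  next
    fix q assume "q \<in> {p0..n}"
    then show "q \<in> ?B" using antimono[of p0 q] antimono[of q n] p0 by simp
  qed
  moreover have "{p. p < Suc n \<and> lam p = lam n} = ?B" by auto
  ultimately have "Suc n - p0 \<le> k" using Suc.prems(2)[of "lam n"] by simp
  then have "t ^ (Suc n - p0) \<noteq> 1"
    using t p0(1) by (simp add: primitive_root_of_unity_def)
  have "(\<Sum>p\<in>?B. t ^ (n - p)) = (\<Sum>r<Suc n - p0. t ^ r)"
    unfolding \<open>?B = {p0..n}\<close>
    by (rule sum.reindex_bij_witness[of _ "\<lambda>r. n - r" "\<lambda>p. n - p"]) auto
  then have "(1 - t) * (\<Sum>p\<in>?B. t ^ (n - p)) = 1 - t ^ (Suc n - p0)"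
    by (simp only: one_diff_power_eq)
  then have "(\<Sum>p\<in>?B. t ^ (n - p)) \<noteq> 0"
    using \<open>t ^ (Suc n - p0) \<noteq> 1\<close> by auto
  moreover have "(\<Sum>u\<in>stabilizer n lam. inversion_weight t n u) \<noteq> 0"
  proof (rule Suc.IH)
    show "card {p. p < n \<and> lam p = i} \<le> k" for i
      by (rule order_trans[OF card_mono Suc.prems(2)[of i]]) auto
  qed (use Suc.prems(1) in auto)
  ultimately show ?case
    using sum_stabilizer_Suc[OF antimono] by simp
qed

text \<open>Leading exponents add under multiplication, so the Vandermonde exponent cancels from
  that of the numerator.\<close>

lemma lead_term_hl_sum:
  assumes "primitive_root_of_unity (k + 1) t"
    and "\<And>i j. i \<le> j \<Longrightarrow> j < n \<Longrightarrow> lam j \<le> lam i" "\<And>i. card {p. p < n \<and> lam p = i} \<le> k"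
  shows "\<exists>c. c \<noteq> 0 \<and> lead_term (hl_sum t n lam) (exponent n lam) c"
proof -
  let ?R = "hl_sum t n lam" and ?S = "\<Sum>w\<in>stabilizer n lam. inversion_weight t n w"
  have S: "?S \<noteq> 0" by (rule sum_stabilizer_nonzero[OF assms])
  have num: "lead_term (vandermonde n * ?R) (exponent n lam + vandermonde_exponent n) ?S"
    unfolding vandermonde_hl_sum by (rule lead_term_hl_numerator[OF assms(2)])
  have "?R \<noteq> 0"
  proof
    assume "?R = 0"
    then show False using lead_term_lookup[OF num] S by simp
  qed
  let ?\<mu> = "Max (keys ?R)" and ?c = "lookup ?R (Max (keys ?R))"
  have lead: "lead_term ?R ?\<mu> ?c" using \<open>?R \<noteq> 0\<close> by (rule lead_term_Max)
  have c: "?c \<noteq> 0" using \<open>?R \<noteq> 0\<close> by (rule lookup_Max_keys)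
  have "vandermonde_exponent n + ?\<mu> = exponent n lam + vandermonde_exponent n"
    using lead_term_unique[OF lead_term_mult[OF lead_term_vandermonde lead] num] S c by simp
  then have "?\<mu> = exponent n lam" by (simp add: add.commute)
  then show ?thesis using lead c by auto
qed

section \<open>Leading exponents of polynomials in \<open>F_space\<close>\<close>

text \<open>The exponent of a monomial after variable \<open>i\<close> is replaced by a multiple of
  variable \<open>e i\<close>; entries landing on the same variable add up.\<close>

definition push_exponent :: "(nat \<Rightarrow> nat) \<Rightarrow> (nat \<Rightarrow>\<^sub>0 nat) \<Rightarrow> (nat \<Rightarrow>\<^sub>0 nat)" where
  "push_exponent e m = (\<Sum>i\<in>keys m. single (e i) (lookup m i))"

lemma lookup_push_exponent:
  assumes "finite A" "keys m \<subseteq> A"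
  shows "lookup (push_exponent e m) l = (\<Sum>i | i \<in> A \<and> e i = l. lookup m i)"
proof -
  have "lookup (push_exponent e m) l = (\<Sum>i\<in>keys m. if e i = l then lookup m i else 0)"
    unfolding push_exponent_def lookup_sum by (intro sum.cong) (auto simp: lookup_single when_def)
  also have "\<dots> = (\<Sum>i\<in>A. if e i = l then lookup m i else 0)"
    using assms by (intro sum.mono_neutral_left) (auto simp: in_keys_iff)
  also have "\<dots> = (\<Sum>i | i \<in> A \<and> e i = l. lookup m i)"
    using assms(1) by (simp add: sum.inter_filter)
  finally show ?thesis .
qed

lemma lookup_push_exponent_inj:
  assumes "inj e"
  shows "lookup (push_exponent e m) (e j) = lookup m j"
proof -
  have "{i. i \<in> insert j (keys m) \<and> e i = e j} = {j}" using assms by (auto dest: injD)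
  then show ?thesis by (subst lookup_push_exponent[of "insert j (keys m)"]) auto
qed

lemma lookup_msubst_scaled_var:
  "lookup (msubst (\<lambda>i. mconst (c i) * mvar (e i)) f) \<nu> =
    (\<Sum>m\<in>keys f. if push_exponent e m = \<nu> then lookup f m * (\<Prod>i\<in>keys m. c i ^ lookup m i) else 0)"
  unfolding msubst_superset[OF finite_keys order_refl] monomial_subst_scaled_var lookup_sum
    push_exponent_def[symmetric]
  by (intro sum.cong) (auto simp: mconst_def mult_single lookup_single when_def)

text \<open>A permutation acts injectively on exponents, so no other monomial of \<open>f\<close>
  can cancel the image of \<open>m\<close>.\<close>

lemma sym_cmpolys_keys_permute:
  assumes f: "f \<in> sym_cmpolys n" and w: "w permutes {..<n}" and m: "m \<in> keys f"
  shows "push_exponent w m \<in> keys f"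
proof -
  have inj: "push_exponent w m' = push_exponent w m \<longleftrightarrow> m' = m" for m'
  proof
    assume eq: "push_exponent w m' = push_exponent w m"
    show "m' = m"
      by (rule poly_mapping_eqI) (metis eq lookup_push_exponent_inj permutes_inj[OF w])
  qed simp
  have "f = msubst (\<lambda>i. mconst 1 * mvar (w i)) f" using f w by (simp add: sym_cmpolys_def)
  then have "lookup f (push_exponent w m) = (\<Sum>m'\<in>keys f. if m' = m then lookup f m' else 0)"
    using lookup_msubst_scaled_var[of "\<lambda>_. 1" w f "push_exponent w m"] by (simp add: inj)
  then show ?thesis using m by (simp add: in_keys_iff)
qed

text \<open>Otherwise transposing \<open>i\<close> and \<open>j\<close> in \<open>m\<close> would give a larger exponent than \<open>\<mu>\<close>.\<close>

lemma sym_cmpolys_swap_le: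
  assumes f: "f \<in> sym_cmpolys n" and max: "\<And>m. m \<in> keys f \<Longrightarrow> m \<le> \<mu>"
    and m: "m \<in> keys f" "i \<le> j" "j < n" "\<And>l. l < i \<Longrightarrow> lookup m l = lookup \<mu> l"
  shows "lookup m j \<le> lookup \<mu> i"
proof (rule ccontr)
  assume "\<not> ?thesis"
  then have less: "lookup \<mu> i < lookup m j" by simp
  let ?m = "push_exponent (transpose i j) m"
  have lookup: "lookup ?m (transpose i j l) = lookup m l" for l
    by (rule lookup_push_exponent_inj) (rule inj_transpose)
  have "transpose i j permutes {..<n}" using m by (intro permutes_swap_id) auto
  then have "?m \<le> \<mu>" using max sym_cmpolys_keys_permute[OF f _ m(1)] by blast
  moreover have "\<mu> < ?m"
    unfolding lookup_less_iff
  proof (intro exI[of _ i] conjI allI impI)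
    show "lookup \<mu> i < lookup ?m i" using less lookup[of j] by simp
    fix l assume "l < i"
    then show "lookup \<mu> l = lookup ?m l" using lookup[of l] m(2,4) by simp
  qed
  ultimately show False by simp
qed

lemma F_space_lead_no_block:
  assumes f: "f \<in> F_space n k t" "f \<noteq> 0" and t: "t \<noteq> 0"
    and \<mu>: "\<mu> = Max (keys f)" and block: "i + k < n" "\<And>j. j \<le> k \<Longrightarrow> lookup \<mu> (i + j) = a"
  shows False
proof -
  let ?\<theta> = "\<lambda>i. if i \<le> k then mconst (t ^ i) * mvar 0 else mvar i"
  have sym: "f \<in> sym_cmpolys n" and vanish: "msubst ?\<theta> f = 0"
    using f block(1) by (auto simp: F_space_def)
  have max: "m \<le> \<mu>" if "m \<in> keys f" for m using that by (simp add: \<mu>)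
  have \<mu>_key: "\<mu> \<in> keys f" using f(2) by (simp add: \<mu>)
  have keys_n: "keys m \<subseteq> {..<n}" if "m \<in> keys f" for m
    using sym that by (auto simp: sym_cmpolys_def cmpolys_def)
  \<comment> \<open>\<open>w\<close> brings the block \<open>i, ..., i + k\<close> to the front,
    where the vanishing condition applies, and shifts the first \<open>i\<close> variables behind
    it. \<open>c\<close> and \<open>e\<close> describe the composite substitution.\<close>
  define w where "w l = (if l < i then l + k + 1 else if l \<le> i + k then l - i else l)" for l
  define c where "c l = (if i \<le> l \<and> l \<le> i + k then t ^ (l - i) else 1)" for l
  define e where "e l = (if i \<le> l \<and> l \<le> i + k then 0 else w l)" for l
  have "w permutes {..<n}"
    by (rule inj_imp_permutes) (use block(1) in \<open>auto simp: w_def inj_on_def split: if_splits\<close>)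
  then have "msubst (\<lambda>l. mvar (w l)) f = f" using sym by (simp add: sym_cmpolys_def)
  then have "msubst (\<lambda>l. ?\<theta> (w l)) f = 0"
    using vanish msubst_msubst[of ?\<theta> "\<lambda>l. mvar (w l)" f] by (simp only: msubst_mvar)
  moreover have "(\<lambda>l. ?\<theta> (w l)) = (\<lambda>l. mconst (c l) * mvar (e l))"
    by (auto simp: fun_eq_iff w_def c_def e_def)
  ultimately have zero: "msubst (\<lambda>l. mconst (c l) * mvar (e l)) f = 0" by simp
  \<comment> \<open>Off the block \<open>e\<close> is injective and avoids \<open>0\<close>, so
    those entries agree. On the block only the sums agree, but each entry of \<open>m\<close> is at
    most the constant value \<open>a\<close> of \<open>\<mu>\<close>, which forces equality.\<close>
  have unique: "m = \<mu>" if m: "m \<in> keys f" and eq: "push_exponent e m = push_exponent e \<mu>" for m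
  proof -
    have outside: "lookup m l = lookup \<mu> l" if l: "l < i \<or> i + k < l" for l
    proof (cases "l < n")
      case True
      have "{q. q \<in> {..<n} \<and> e q = e l} = {l}"
        using True l by (auto simp: e_def w_def split: if_splits)
      then have "lookup (push_exponent e m') (e l) = lookup m' l" if "m' \<in> keys f" for m'
        using lookup_push_exponent[OF _ keys_n[OF that], of e "e l"] by simp
      then show ?thesis using eq m \<mu>_key by metis
    next
      case False
      then have "l \<notin> keys m" "l \<notin> keys \<mu>" using keys_n[OF m] keys_n[OF \<mu>_key] by auto
      then show ?thesis by (simp add: in_keys_iff)
    qed
    have "{q. q \<in> {..<n} \<and> e q = 0} = {i..i + k}"
      using block(1) by (auto simp: e_def w_def split: if_splits)
    then have "lookup (push_exponent e m') 0 = (\<Sum>l\<in>{i..i + k}. lookup m' l)" if "m' \<in> keys f" for m'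
      using lookup_push_exponent[OF _ keys_n[OF that], of e 0] by simp
    then have sum_eq: "(\<Sum>l\<in>{i..i + k}. lookup m l) = (\<Sum>l\<in>{i..i + k}. lookup \<mu> l)"
      using eq m \<mu>_key by metis
    have \<mu>_block: "lookup \<mu> l = a" if "l \<in> {i..i + k}" for l
      using block(2)[of "l - i"] that by auto
    have le: "lookup m l \<le> lookup \<mu> l" if "l \<in> {i..i + k}" for l
    proof -
      have "lookup m l \<le> lookup \<mu> i"
        by (rule sym_cmpolys_swap_le[OF sym max m]) (use that block(1) outside in auto)
      then show ?thesis using \<mu>_block[OF that] \<mu>_block[of i] by simp
    qed
    have inside: "lookup m l = lookup \<mu> l" if l: "l \<in> {i..i + k}" for l
      by (rule sum_mono_inv[OF sum_eq le l]) auto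
    show ?thesis
    proof (rule poly_mapping_eqI)
      fix l show "lookup m l = lookup \<mu> l"
        using inside[of l] outside[of l] by (cases "l < i \<or> i + k < l") auto
    qed
  qed
  have "0 = (\<Sum>m\<in>keys f. if push_exponent e m = push_exponent e \<mu>
      then lookup f m * (\<Prod>i\<in>keys m. c i ^ lookup m i) else 0)"
    using lookup_msubst_scaled_var[of c e f "push_exponent e \<mu>"] by (simp add: zero)
  also have "\<dots> = (\<Sum>m\<in>keys f. if m = \<mu> then lookup f m * (\<Prod>i\<in>keys m. c i ^ lookup m i) else 0)"
    using unique by (intro sum.cong refl if_cong) auto
  also have "\<dots> = lookup f \<mu> * (\<Prod>i\<in>keys \<mu>. c i ^ lookup \<mu> i)"
    using \<mu>_key by simp
  also have "\<dots> \<noteq> 0"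
  proof -
    have "c l \<noteq> 0" for l using t by (simp add: c_def)
    then show ?thesis using \<mu>_key by (simp add: in_keys_iff)
  qed
  finally show False by simp
qed

section \<open>Leading exponents as admissible partitions\<close>

lemma count_list_eq_card: "count_list xs v = card {p. p < length xs \<and> xs ! p = v}"
  by (simp add: count_list_eq_length_filter length_filter_conv_card eq_commute)

lemma F_space_lead_exponent:
  assumes f: "f \<in> F_space n k t" "f \<noteq> 0" and t: "t \<noteq> 0"
  shows "\<exists>lam\<in>partitions_len n. admissible k lam \<and> Max (keys f) = exponent n ((!) lam)"
proof -
  define \<mu> where "\<mu> = Max (keys f)"
  define lam where "lam = map (lookup \<mu>) [0..<n]"
  have sym: "f \<in> sym_cmpolys n" using f by (simp add: F_space_def)
  have \<mu>_key: "\<mu> \<in> keys f" using f(2) by (simp add: \<mu>_def)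
  have keys_n: "keys \<mu> \<subseteq> {..<n}"
    using sym \<mu>_key by (auto simp: sym_cmpolys_def cmpolys_def)
  have antimono: "lookup \<mu> j \<le> lookup \<mu> i" if "i \<le> j" "j < n" for i j
    by (rule sym_cmpolys_swap_le[OF sym _ \<mu>_key that]) (auto simp: \<mu>_def)
  have "lam \<in> partitions_len n"
    using antimono by (auto simp: partitions_len_def lam_def sorted_wrt_iff_nth_less)
  moreover have "admissible k lam"
    unfolding admissible_def
  proof (rule allI, rule ccontr)
    fix v assume "\<not> count_list lam v \<le> k"
    define S where "S = {p. p < n \<and> lookup \<mu> p = v}"
    have "{p. p < length lam \<and> lam ! p = v} = S" by (auto simp: S_def lam_def)
    then have card: "k < card S"
      using \<open>\<not> count_list lam v \<le> k\<close> by (simp add: count_list_eq_card)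
    then have fin: "finite S" and ne: "S \<noteq> {}" using card_gt_0_iff[of S] by auto
    \<comment> \<open>More than \<open>k\<close> positions with value \<open>v\<close> span an
      interval of at least \<open>k + 1\<close> positions, on which monotonicity makes
      \<open>\<mu>\<close> constant: the forbidden block.\<close>
    have "card S \<le> card {Min S..Max S}"
      using fin by (intro card_mono) auto
    then have le: "Min S + k \<le> Max S" using card by simp
    have S: "Min S \<in> S" "Max S \<in> S" using fin ne by simp_all
    show False
    proof (rule F_space_lead_no_block[OF f t \<mu>_def])
      show "Min S + k < n" using le S(2) by (simp add: S_def)
      fix j assume "j \<le> k"
      then show "lookup \<mu> (Min S + j) = v"
        using antimono[of "Min S" "Min S + j"] antimono[of "Min S + j" "Max S"] le S
        by (simp add: S_def)
    qed
  qed
  moreover have "\<mu> = exponent n ((!) lam)"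
  proof (rule poly_mapping_eqI)
    fix l show "lookup \<mu> l = lookup (exponent n ((!) lam)) l"
      using keys_n by (auto simp: lookup_exponent lam_def in_keys_iff)
  qed
  ultimately show ?thesis unfolding \<mu>_def by blast
qed

section \<open>Bases by leading exponents\<close>

interpretation cmpoly: vector_space mscale
  by (rule vector_space_mscale)

lemma lookup_mscale: "lookup (mscale c f) m = c * lookup f m"
  by (simp add: mscale_def mconst_def Poly_Mapping.map.rep_eq when_def
      flip: Poly_Mapping.mult_map_scale_conv_mult)

text \<open>Among the elements with nonzero coefficient in a relation, the one with the largest
  leading exponent is alone in contributing there.\<close>

lemma independent_lead_exponents:
  assumes "0 \<notin> B" "inj_on (\<lambda>f. Max (keys f)) B"
  shows "\<not> cmpoly.dependent B"
proof
  let ?E = "\<lambda>f :: cmpoly. Max (keys f)"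
  assume "cmpoly.dependent B"
  then obtain T u where T: "finite T" "T \<subseteq> B" "(\<Sum>v\<in>T. mscale (u v) v) = 0" "\<exists>v\<in>T. u v \<noteq> 0"
    unfolding cmpoly.dependent_explicit by blast
  let ?U = "{v \<in> T. u v \<noteq> 0}"
  have U: "finite ?U" "?U \<noteq> {}" using T by auto
  then obtain v where v: "v \<in> ?U" "?E v = Max (?E ` ?U)"
    using Max_in[of "?E ` ?U"] by fastforce
  have zero: "u v' * lookup v' (?E v) = 0" if v': "v' \<in> T" "v' \<noteq> v" for v'
  proof (cases "u v' = 0")
    case False
    have "?E v' \<le> ?E v" using v v' U False by simp
    moreover have "v' \<in> B" "v \<in> B" using v v' T(2) by auto
    then have "?E v' \<noteq> ?E v" using v'(2) inj_onD[OF assms(2), of v' v] by blast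
    ultimately have "?E v' < ?E v" by (simp only: order_less_le simp_thms)
    then have "?E v \<notin> keys v'" using Max_ge[OF finite_keys, of "?E v" v'] leD by blast
    then show ?thesis by (simp add: in_keys_iff)
  qed simp
  have "0 = lookup (\<Sum>v\<in>T. mscale (u v) v) (?E v)" using T(3) by simp
  also have "\<dots> = (\<Sum>v'\<in>T. u v' * lookup v' (?E v))"
    by (simp add: lookup_sum lookup_mscale)
  also have "\<dots> = u v * lookup v (?E v)"
  proof -
    have "(\<Sum>v'\<in>T - {v}. u v' * lookup v' (?E v)) = 0"
      by (intro sum.neutral ballI zero) auto
    moreover have "v \<in> T" using v(1) by simp
    ultimately show ?thesis using sum.remove[OF T(1), of v "\<lambda>v'. u v' * lookup v' (?E v)"] by simp
  qed
  also have "\<dots> \<noteq> 0"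
    using v T(2) assms(1) lookup_Max_keys[of v] by auto
  finally show False by simp
qed

text \<open>The bound \<open>n\<close> matters: in infinitely many variables
  \<open>x_0 > x_1 > x_2 > ...\<close> descends forever. The first difference lies in the support of
  the larger exponent, hence below \<open>n\<close>, so lists of length \<open>n\<close>
  suffice.\<close>

lemma wf_exponents:
  "wf {(m :: nat \<Rightarrow>\<^sub>0 nat, m'). m < m' \<and> keys m' \<subseteq> {..<n}}"
proof (rule wf_subset)
  let ?l = "\<lambda>m :: nat \<Rightarrow>\<^sub>0 nat. map (lookup m) [0..<n]"
  show "wf (inv_image (lexn less_than n) ?l)"
    by (intro wf_inv_image wf_lexn wf_less_than)
  show "{(m, m'). m < m' \<and> keys m' \<subseteq> {..<n}} \<subseteq> inv_image (lexn less_than n) ?l"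
  proof clarify
    fix m m' :: "nat \<Rightarrow>\<^sub>0 nat"
    assume "m < m'" and keys: "keys m' \<subseteq> {..<n}"
    then obtain i where i: "lookup m i < lookup m' i" "\<forall>j<i. lookup m j = lookup m' j"
      unfolding lookup_less_iff by auto
    then have "i \<in> keys m'" by (simp add: in_keys_iff)
    then have "i < n" using keys by auto
    then have upt: "[0..<n] = [0..<i] @ i # [Suc i..<n]"
      using upt_add_eq_append[of 0 i "n - i"] by (simp add: upt_conv_Cons)
    have "map (lookup m) [0..<i] = map (lookup m') [0..<i]" using i(2) by simp
    then have "?l m = map (lookup m') [0..<i] @ lookup m i # map (lookup m) [Suc i..<n]"
      "?l m' = map (lookup m') [0..<i] @ lookup m' i # map (lookup m') [Suc i..<n]"
      unfolding upt by simp_all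
    then show "(m, m') \<in> inv_image (lexn less_than n) ?l"
      unfolding in_inv_image lexn_conv using i(1) \<open>i < n\<close> by auto
  qed
qed

text \<open>Reduction as in polynomial division: subtracting a multiple of a suitable
  \<open>b\<close> removes the leading term of \<open>f\<close>, and this terminates by
  well-foundedness.\<close>

lemma span_lead_exponents:
  assumes F: "cmpoly.subspace F" "F \<subseteq> cmpolys n" and B: "B \<subseteq> F"
    and lead: "\<And>f. f \<in> F \<Longrightarrow> f \<noteq> 0 \<Longrightarrow> \<exists>b\<in>B. b \<noteq> 0 \<and> Max (keys b) = Max (keys f)"
  shows "cmpoly.span B = F"
proof
  show "cmpoly.span B \<subseteq> F" using B F(1) by (rule cmpoly.span_minimal)
  have "f \<in> F \<Longrightarrow> f \<noteq> 0 \<Longrightarrow> Max (keys f) = \<mu> \<Longrightarrow> f \<in> cmpoly.span B" for \<mu> f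
    using wf_exponents[of n]
  proof (induction \<mu> arbitrary: f rule: wf_induct_rule)
    case (less \<mu>)
    obtain b where b: "b \<in> B" "b \<noteq> 0" "Max (keys b) = \<mu>" using lead[OF less.prems(1,2)] less.prems(3) by auto
    define s where "s = lookup f \<mu> / lookup b \<mu>"
    define f' where "f' = f - mscale s b"
    have b_nz: "lookup b \<mu> \<noteq> 0" using lookup_Max_keys[OF b(2)] b(3) by simp
    have "\<mu> \<in> keys f" using less.prems by auto
    then have keys_\<mu>: "keys \<mu> \<subseteq> {..<n}" using less.prems(1) F(2) by (auto simp: cmpolys_def)
    have "f' \<in> F"
      unfolding f'_def using F(1) less.prems(1) B b(1)
      by (intro cmpoly.subspace_diff cmpoly.subspace_scale) auto
    have "f' \<in> cmpoly.span B"
    proof (cases "f' = 0")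
      case False
      have "lookup f' \<mu> = 0" using b_nz by (simp add: f'_def s_def lookup_minus lookup_mscale)
      then have "\<mu> \<notin> keys f'" by (simp add: in_keys_iff)
      moreover have "m \<le> \<mu>" if "m \<in> keys f'" for m
      proof -
        have "m \<in> keys f \<or> m \<in> keys b"
          using that by (auto simp: f'_def in_keys_iff lookup_minus lookup_mscale)
        then show ?thesis
          using less.prems(3) b(3) Max_ge[of "keys f" m] Max_ge[of "keys b" m] by auto
      qed
      moreover have "Max (keys f') \<in> keys f'" using False by simp
      ultimately have "Max (keys f') < \<mu>" by (metis order_less_le)
      then show ?thesis
        using less.IH[of "Max (keys f')" f'] \<open>f' \<in> F\<close> False keys_\<mu> by simp
    qed (simp add: cmpoly.span_zero)
    moreover have "mscale s b \<in> cmpoly.span B" using b(1) by (simp add: cmpoly.span_base cmpoly.span_scale)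
    ultimately have "f' + mscale s b \<in> cmpoly.span B" by (rule cmpoly.span_add)
    then show ?case by (simp add: f'_def)
  qed
  then show "F \<subseteq> cmpoly.span B" by (metis cmpoly.span_zero subsetI)
qed

lemma subspace_F_space: "cmpoly.subspace (F_space n k t)"
proof (rule cmpoly.subspaceI)
  show "0 \<in> F_space n k t"
    by (simp add: F_space_def sym_cmpolys_def cmpolys_def)
next
  fix f g assume fg: "f \<in> F_space n k t" "g \<in> F_space n k t"
  then have "f + g \<in> cmpolys n"
    using keys_add[of f g] by (auto simp: F_space_def sym_cmpolys_def cmpolys_def)
  then show "f + g \<in> F_space n k t"
    using fg by (simp add: F_space_def sym_cmpolys_def msubst_add)
next
  fix c f assume f: "f \<in> F_space n k t"
  have "keys (mscale c f) \<subseteq> keys f" by (auto simp: in_keys_iff lookup_mscale)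
  then have "mscale c f \<in> cmpolys n"
    using f by (auto simp: F_space_def sym_cmpolys_def cmpolys_def)
  then show "mscale c f \<in> F_space n k t"
    using f by (simp add: F_space_def sym_cmpolys_def msubst_mscale)
qed

section \<open>Hall--Littlewood polynomials\<close>

lemma to_fract_prod: "to_fract (\<Prod>i\<in>A. f i) = (\<Prod>i\<in>A. to_fract (f i))"
  by (induction A rule: infinite_finite_induct) auto

lemma to_fract_power: "to_fract (x ^ j) = to_fract x ^ j"
  by (induction j) auto

text \<open>The signs bring all summands over the one denominator \<open>vandermonde\<close>, and
  the numerators then add up to \<open>hl_numerator\<close>.\<close>

lemma hall_littlewood_eq_hl_sum:
  "hall_littlewood t lam =
    mscale (\<Prod>i\<in>set lam. \<Prod>j = 1..count_list lam i. (1 - t) / (1 - t ^ j))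
      (hl_sum t (length lam) ((!) lam))"
proof (rule hall_littlewood_eqI)
  let ?n = "length lam"
  let ?V = "to_fract (vandermonde ?n)"
  have V: "?V \<noteq> 0" by (simp add: vandermonde_nonzero)
  have term_eq: "(\<Prod>i<?n. to_fract (mvar (w i)) ^ (lam ! i)) *
         (\<Prod>(i, j)\<in>{(i, j). i < j \<and> j < ?n}.
            to_fract (mvar (w i) - mconst t * mvar (w j)) / to_fract (mvar (w i) - mvar (w j))) =
       to_fract (inversion_sign ?n w * monom_perm ((!) lam) ?n w * pair_prod t ?n w) / ?V"
    if w: "w permutes {..<?n}" for w
  proof -
    have mono: "(\<Prod>i<?n. to_fract (mvar (w i)) ^ (lam ! i)) = to_fract (monom_perm ((!) lam) ?n w)"
      by (simp only: monom_perm_def to_fract_prod to_fract_power)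
    have quot: "(\<Prod>(i, j)\<in>{(i, j). i < j \<and> j < ?n}.
        to_fract (mvar (w i) - mconst t * mvar (w j)) / to_fract (mvar (w i) - mvar (w j))) =
        to_fract (pair_prod t ?n w) / to_fract (pair_prod 1 ?n w)"
      unfolding pairs_def[symmetric]
      by (simp only: pair_prod_def to_fract_prod case_prod_unfold prod_dividef mconst_1 mult_1)
    have "to_fract (inversion_sign ?n w) * to_fract (pair_prod 1 ?n w) = ?V"
      using inversion_sign_pair_prod[OF w] by (simp only: flip: to_fract_mult)
    moreover have "to_fract (pair_prod 1 ?n w) \<noteq> 0"
      using pair_prod_1_nonzero[OF w] by (simp only: to_fract_eq_0_iff not_False_eq_True)
    moreover have "m * (p / d) = s * m * p / V" if "s * d = V" "d \<noteq> 0" "V \<noteq> 0"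
      for s d V m p :: "cmpoly fract"
      using that by (auto simp: field_simps)
    ultimately show ?thesis
      using V by (simp only: mono quot to_fract_mult)
  qed
  have "(\<Sum>w | w permutes {..<?n}.
         (\<Prod>i<?n. to_fract (mvar (w i)) ^ (lam ! i)) *
         (\<Prod>(i, j)\<in>{(i, j). i < j \<and> j < ?n}.
            to_fract (mvar (w i) - mconst t * mvar (w j)) / to_fract (mvar (w i) - mvar (w j)))) =
      (\<Sum>w | w permutes {..<?n}.
         to_fract (inversion_sign ?n w * monom_perm ((!) lam) ?n w * pair_prod t ?n w) / ?V)"
    by (intro sum.cong refl) (simp only: term_eq mem_Collect_eq)
  also have "\<dots> = to_fract (hl_numerator t ?n ((!) lam)) / ?V"
    by (simp only: hl_numerator_def to_fract_sum sum_divide_distrib)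
  also have "\<dots> = to_fract (hl_sum t ?n ((!) lam))"
    using nonzero_mult_div_cancel_left[OF V] by (simp only: vandermonde_hl_sum[symmetric] to_fract_mult)
  finally show "to_fract (mscale (\<Prod>i\<in>set lam. \<Prod>j = 1..count_list lam i. (1 - t) / (1 - t ^ j))
      (hl_sum t ?n ((!) lam))) = hall_littlewood_fract t lam"
    unfolding hall_littlewood_fract_def Let_def by (simp only: mscale_def to_fract_mult)
qed

lemma hall_littlewood_admissible:
  assumes k: "k \<ge> 1" and t: "primitive_root_of_unity (k + 1) t"
    and lam: "lam \<in> partitions_len n" "admissible k lam"
  shows "hall_littlewood t lam \<in> F_space n k t" "hall_littlewood t lam \<noteq> 0"
    "Max (keys (hall_littlewood t lam)) = exponent n ((!) lam)"
proof -
  define C where "C = (\<Prod>i\<in>set lam. \<Prod>j = 1..count_list lam i. (1 - t) / (1 - t ^ j))"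
  have len: "length lam = n" using lam(1) by (simp add: partitions_len_def)
  have hl: "hall_littlewood t lam = mscale C (hl_sum t n ((!) lam))"
    using hall_littlewood_eq_hl_sum[of t lam] by (simp add: C_def len)
  have antimono: "lam ! j \<le> lam ! i" if "i \<le> j" "j < n" for i j
    using lam(1) that by (cases "i = j") (auto simp: partitions_len_def sorted_wrt_iff_nth_less)
  have card: "card {p. p < n \<and> lam ! p = i} \<le> k" for i
    using lam(2) by (simp add: admissible_def count_list_eq_card len)
  have t_ne: "t ^ j \<noteq> 1" if "0 < j" "j \<le> k" for j
    using t that by (simp add: primitive_root_of_unity_def)
  \<comment> \<open>The scalar is nonzero since \<open>t \<noteq> 1\<close>, by
    \<open>k \<ge> 1\<close>, and since admissibility keeps every \<open>j\<close> in the
    denominators at most \<open>k\<close>.\<close>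
  have "1 - t \<noteq> 0" using t_ne[of 1] k by auto
  moreover have "1 - t ^ j \<noteq> 0" if "j \<in> {1..count_list lam i}" for i j
    using t_ne[of j] lam(2) that by (auto simp: admissible_def intro: order_trans)
  ultimately have C: "C \<noteq> 0" by (auto simp: C_def)
  show "hall_littlewood t lam \<in> F_space n k t"
    unfolding hl by (rule cmpoly.subspace_scale[OF subspace_F_space hl_sum_F_space[OF k t]])
  obtain c where c: "c \<noteq> 0" "lead_term (hl_sum t n ((!) lam)) (exponent n ((!) lam)) c"
    using lead_term_hl_sum[OF t antimono card] by auto
  have lead: "lead_term (hall_littlewood t lam) (exponent n ((!) lam)) (C * c)"
    using lead_term_mult[OF lead_term_mconst[of C] c(2)] by (simp add: hl mscale_def)
  show nz: "hall_littlewood t lam \<noteq> 0"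
    using lead_term_lookup[OF lead] C c(1) by auto
  show "Max (keys (hall_littlewood t lam)) = exponent n ((!) lam)"
    using lead_term_unique[OF lead_term_Max[OF nz] lead lookup_Max_keys[OF nz]] C c(1) by simp
qed

text \<open>Injectivity is stated separately because independence and span concern only the image
  set; together they make the indexed family a basis.\<close>

theorem proposition3p5:
  fixes k n :: nat and t :: complex
  assumes "k \<ge> 1" and "n \<ge> 1" and "primitive_root_of_unity (k + 1) t"
  defines "A \<equiv> {lam \<in> partitions_len n. admissible k lam}"
  shows "inj_on (hall_littlewood t) A \<and>
         \<not> module.dependent mscale (hall_littlewood t ` A) \<and>
         module.span mscale (hall_littlewood t ` A) = F_space n k t"
proof -
  have hl: "hall_littlewood t lam \<in> F_space n k t" "hall_littlewood t lam \<noteq> 0"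
    "Max (keys (hall_littlewood t lam)) = exponent n ((!) lam)" if "lam \<in> A" for lam
    using hall_littlewood_admissible[OF assms(1,3), of lam n] that by (simp_all add: A_def)
  \<comment> \<open>All lists in \<open>A\<close> have length \<open>n\<close>, so the leading
    exponent determines the partition, trailing zeros included.\<close>
  have lam_eq: "lam = lam'"
    if "lam \<in> A" "lam' \<in> A"
      "Max (keys (hall_littlewood t lam)) = Max (keys (hall_littlewood t lam'))" for lam lam'
  proof (rule nth_equalityI)
    show "length lam = length lam'" using that by (simp add: A_def partitions_len_def)
    fix i assume "i < length lam"
    then have "i < n" using that by (simp add: A_def partitions_len_def)
    then show "lam ! i = lam' ! i" using that by (simp add: hl exponent_eq_iff)
  qed
  have t: "t \<noteq> 0" using assms(3) by (auto simp: primitive_root_of_unity_def)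
  have "inj_on (hall_littlewood t) A"
    by (rule inj_onI) (simp add: lam_eq)
  moreover have "\<not> module.dependent mscale (hall_littlewood t ` A)"
  proof (rule independent_lead_exponents)
    show "0 \<notin> hall_littlewood t ` A" using hl(2) by force
    show "inj_on (\<lambda>f. Max (keys f)) (hall_littlewood t ` A)"
      by (rule inj_onI) (use lam_eq in blast)
  qed
  moreover have "module.span mscale (hall_littlewood t ` A) = F_space n k t"
  proof (rule span_lead_exponents[OF subspace_F_space])
    show "F_space n k t \<subseteq> cmpolys n" by (auto simp: F_space_def sym_cmpolys_def)
    show "hall_littlewood t ` A \<subseteq> F_space n k t" using hl(1) by auto
    fix f assume "f \<in> F_space n k t" "f \<noteq> 0"
    then obtain lam where "lam \<in> A" "Max (keys f) = exponent n ((!) lam)"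
      using F_space_lead_exponent[OF _ _ t, of f n k] by (auto simp: A_def)
    then show "\<exists>b\<in>hall_littlewood t ` A. b \<noteq> 0 \<and> Max (keys b) = Max (keys f)"
      using hl by (intro bexI[of _ "hall_littlewood t lam"]) auto
  qed
  ultimately show ?thesis by blast
qed

end
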